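(* Consider the two-tubes IPM equations (defined in the context). (A) There exist $l_0,\delta>0$ such that for all $v\in(-\tfrac14-\delta,-\tfrac14+\delta)$ and $l\in(0,l_0)$ there exists a traveling wave solution $(c_1,c_2,u_1,u_2,q)(y-vt)$ with speed $v$ satisfying $(c_1,c_2,u_1,u_2,q)(-\infty)=(-1,-1,0,0,0)$ and connecting $$(-1,-1,0,0,0)\ \text{ to }\ \Big(c_1^*,c_2^*,\tfrac{c_2^*-c_1^*}{2},\tfrac{c_1^*-c_2^*}{2},0\Big),$$ where $c_i^*=c_i^*(v,l)$ depend continuously on $(v,l)\in(-\tfrac14-\delta,-\tfrac14+\delta)\times(0,l_0)$ and, for fixed $v$, $c_1^*(v,l)\to-6v-1$ and $c_2^*(v,l)\to-2v-1$ as $l\to0$. (B) There exist $l_0,\delta>0$ such that for all $v\in(\tfrac14-\delta,\tfrac14+\delta)$ and $l\in(0,l_0)$ there exists a traveling wave solution $(c_1,c_2,u_1,u_2,q)(y-vt)$ with speed $v$ satisfying $(c_1,c_2,u_1,u_2,q)(+\infty)=(1,1,0,0,0)$ and connecting $$\Big(c_1^{**},c_2^{**},\tfrac{c_2^{**}-c_1^{**}}{2},\tfrac{c_1^{**}-c_2^{**}}{2},0\Big)\ \text{ to }\ (1,1,0,0,0),$$ where $c_i^{**}=c_i^{**}(v,l)$ depend continuously on $(v,l)\in(\tfrac14-\delta,\tfrac14+\delta)\times(0,l_0)$ and, for fixed $v$, $c_1^{**}(v,l)\to-2v+1$ and $c_2^{**}(v,l)\to-6v+1$ as $l\to0$.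
   Context: Two-tubes IPM equations with parameter $l>0$: unknowns $c_1,c_2,u_1,u_2,q$, real functions of $(t,y)\in[0,\infty)\times\mathbb{R}$, satisfying $$\partial_t c_1+\partial_y(u_1c_1)-\partial_{yy}c_1=-f,\qquad \partial_t c_2+\partial_y(u_2c_2)-\partial_{yy}c_2=f,$$ $$\partial_y q=u_1-u_2+c_1-c_2,\qquad \partial_y u_1=\frac{q}{l^2},\qquad u_1+u_2=0,$$ where, with $u_T:=-q/l$, $f=\frac{u_T}{l}c_1$ if $u_T\ge0$ and $f=\frac{u_T}{l}c_2$ if $u_T\le0$. A traveling wave with speed $v$ connecting $g_-,g_+\in\mathbb{R}^5$ is a solution of the form $(c_1,c_2,u_1,u_2,q)(t,y)=\tilde g(y-vt)$ with $\tilde g:\mathbb{R}\to\mathbb{R}^5$ continuous (and smooth enough to solve the equations classically), $\tilde g(-\infty)=g_-$, $\tilde g(+\infty)=g_+$. (In the paper, $\pm\tfrac14$ are the speeds $v_1^*,v_2^*$ of the traveling waves of the associated TFE model.) *)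

theory Defs
  imports "HOL-Analysis.Analysis"
begin

definition ipm_f :: "real \<Rightarrow> real \<Rightarrow> real \<Rightarrow> real \<Rightarrow> real" where
  "ipm_f l c1 c2 q = (let uT = - q / l in if uT \<ge> 0 then uT / l * c1 else uT / l * c2)"

definition ipm_solution ::
  "real \<Rightarrow> (real \<Rightarrow> real \<Rightarrow> real) \<Rightarrow> (real \<Rightarrow> real \<Rightarrow> real) \<Rightarrow> (real \<Rightarrow> real \<Rightarrow> real)
   \<Rightarrow> (real \<Rightarrow> real \<Rightarrow> real) \<Rightarrow> (real \<Rightarrow> real \<Rightarrow> real) \<Rightarrow> bool" where
  "ipm_solution l c1 c2 u1 u2 q \<longleftrightarrow>
    (\<forall>t\<ge>0. \<forall>y.
       (\<exists>a b d.
          ((\<lambda>s. c1 s y) has_real_derivative a) (at t within {0..}) \<and>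
          ((\<lambda>z. u1 t z * c1 t z) has_real_derivative b) (at y) \<and>
          (\<forall>z. (\<lambda>w. c1 t w) differentiable (at z)) \<and>
          (deriv (\<lambda>w. c1 t w) has_real_derivative d) (at y) \<and>
          a + b - d = - ipm_f l (c1 t y) (c2 t y) (q t y)) \<and>
       (\<exists>a b d.
          ((\<lambda>s. c2 s y) has_real_derivative a) (at t within {0..}) \<and>
          ((\<lambda>z. u2 t z * c2 t z) has_real_derivative b) (at y) \<and>
          (\<forall>z. (\<lambda>w. c2 t w) differentiable (at z)) \<and>
          (deriv (\<lambda>w. c2 t w) has_real_derivative d) (at y) \<and>
          a + b - d = ipm_f l (c1 t y) (c2 t y) (q t y)) \<and>
       ((\<lambda>z. q t z) has_real_derivative (u1 t y - u2 t y + c1 t y - c2 t y)) (at y) \<and>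
       ((\<lambda>z. u1 t z) has_real_derivative (q t y / l\<^sup>2)) (at y) \<and>
       u1 t y + u2 t y = 0)"

definition ipm_traveling_wave ::
  "real \<Rightarrow> real \<Rightarrow> real \<times> real \<times> real \<times> real \<times> real \<Rightarrow> real \<times> real \<times> real \<times> real \<times> real \<Rightarrow> bool" where
  "ipm_traveling_wave l v gm gp \<longleftrightarrow>
    (\<exists>C1 C2 U1 U2 Q :: real \<Rightarrow> real.
       continuous_on UNIV (\<lambda>x. (C1 x, C2 x, U1 x, U2 x, Q x)) \<and>
       ((\<lambda>x. (C1 x, C2 x, U1 x, U2 x, Q x)) \<longlongrightarrow> gm) at_bot \<and>
       ((\<lambda>x. (C1 x, C2 x, U1 x, U2 x, Q x)) \<longlongrightarrow> gp) at_top \<and>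
       ipm_solution l (\<lambda>t y. C1 (y - v * t)) (\<lambda>t y. C2 (y - v * t))
                      (\<lambda>t y. U1 (y - v * t)) (\<lambda>t y. U2 (y - v * t)) (\<lambda>t y. Q (y - v * t)))"

end

theory Submission
  imports Defs
begin

text \<open>
  The scaling (C + 1, U, v, x) to (c (C + 1), c U, c v, x / c) and a reflection reduce everything
  to waves of speed -1 depending only on the stiffness kappa = sqrt 2 / (|v| l).
  Put W_i = C_i + 1, G = W_1', H = W_2', D = W_1 - W_2 and V = -U'. As long as V is nonnegative the profile satisfies
  G' = (1 + U) G, H' = (1 - U) H - V D, V' = -kappa^2 (U + D/2).
  For kappa = infinity one has U = -D/2 and the explicit logistic solution W_1 = 6 s, W_2 = 2 s, U = -2 s.

  For finite kappa use s = W_1 / W_1(+infinity), in (0,1), as independent variable; this removes the translation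
  invariance and makes both ends of the wave regular. The unknowns are eta = H / G and the two bounded
  solutions alpha, beta of the first-order equations into which V'' = kappa^2 (V - D'/2) splits, relative to G;
  then V / G = (alpha + beta) / 4 =: u, and positivity of V is automatic. As functions of s, both theta = -U
  and G are explicit linear functionals of u, up to the normalisation which makes G vanish at s = 1.
  At the base point alpha = beta = 2/3, eta = 1/3 the three equations have the form z' = c (z - f) or
  z' = -c (z - f) with c > 0, whose bounded solution is an average of f. Hence the solution operators have norm 1,
  the fixed point map is a contraction (factor about 1/2, since u averages alpha and beta with weight 1/4 each
  and alpha, beta are close to 1 - eta), and its fixed point depends continuously on kappa.
\<close>

section \<open>Antiderivatives and bounded solutions of linear equations\<close>

text \<open>The obstacle is that l -> 0 is a singular limit: kappa^2 stands in front of the equation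
  for V', so V has one fast decaying and one fast growing mode, with rates -kappa and +kappa, and
  estimates from initial values blow up with kappa. Boundedness on the whole line selects the right
  solution in each fast direction, with bounds uniform in kappa; a finite kappa then differs from
  the limit problem only by terms of size 1/kappa. The base values come from the logistic solution:
  eta = 2/6, V / G = 2/6, and the fast equations at rest force alpha = beta = 1 - eta. Its heights 6
  and 2 are the coefficients of -v in the limits of the end states. The logistic time y, with s =
  \<open>lg y\<close>, moves the ends s = 0 and s = 1 to infinity, so that a single solution
  operator on the real line serves all three unknowns. The position x is recovered at the end by a
  change of time.\<close>

lemma mono_tendsto_at_bot:
  fixes f :: "real \<Rightarrow> real"
  assumes "mono f" "\<And>x. b \<le> f x"
  shows "\<exists>L. (f \<longlongrightarrow> L) at_bot"
proof -
  have bb: "bdd_below (range f)" using assms(2) by (auto intro!: bdd_belowI[of _ b])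
  have "(f \<longlongrightarrow> (INF x. f x)) at_bot"
  proof (rule order_tendstoI)
    fix a assume "a < (INF x. f x)"
    then show "\<forall>\<^sub>F x in at_bot. a < f x"
      using cINF_lower[OF bb, of _ ] by (intro always_eventually allI) (meson UNIV_I order.strict_trans2)
  next
    fix a assume "(INF x. f x) < a"
    then obtain x where "f x < a" using cINF_less_iff[OF _ bb] by (metis UNIV_not_empty)
    then show "\<forall>\<^sub>F x in at_bot. f x < a"
      unfolding eventually_at_bot_linorder
      using monoD[OF assms(1)] by (intro exI[of _ x]) (meson order.strict_trans1)
  qed
  then show ?thesis by blast
qed

lemma DERIV_mono:
  fixes f :: "real \<Rightarrow> real"
  assumes "\<And>x. (f has_real_derivative f' x) (at x)" "\<And>x. 0 \<le> f' x"
  shows "mono f"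
  by (rule monoI) (meson DERIV_nonneg_imp_nondecreasing assms)

lemma mono_tendsto_at_bot_ge:
  fixes f :: "real \<Rightarrow> real"
  assumes "mono f" "(f \<longlongrightarrow> L) at_bot"
  shows "L \<le> f x"
  using assms(2)
  by (rule tendsto_upperbound)
     (auto simp: eventually_at_bot_linorder intro!: exI[of _ x] monoD[OF assms(1)])

lemma antiderivative_exists:
  fixes f :: "real \<Rightarrow> real"
  assumes "continuous_on UNIV f"
  shows "\<exists>P. \<forall>x. (P has_real_derivative f x) (at x)"
proof -
  define P where "P x = (LBINT t=ereal 0..ereal x. f t)" for x :: real
  have "(P has_real_derivative f x) (at x)" for x
  proof -
    \<comment> \<open>The interval reaches beyond both 0 and x, so that x is an interior point and
      the derivative within the interval is a full derivative.\<close>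
    have "((\<lambda>u. LBINT t=ereal 0..ereal u. f t) has_vector_derivative f x) (at x within {min 0 (x-1)-1..max 0 (x+1)})"
      by (rule interval_integral_FTC2[of "min 0 (x-1) - 1" 0 "max 0 (x+1)" f x])
         (auto intro: continuous_on_subset[OF assms])
    moreover have "at x within {min 0 (x-1)-1..max 0 (x+1)} = at x"
      by (rule at_within_Icc_at) auto
    ultimately show ?thesis
      by (simp add: P_def[abs_def] has_real_derivative_iff_has_vector_derivative)
  qed
  then show ?thesis by blast
qed

text \<open>Chosen by SOME, so \<open>prim\<close> and, below, \<open>bounded_sol\<close> are meaningful only when such functions exist.\<close>
definition prim :: "real filter \<Rightarrow> (real \<Rightarrow> real) \<Rightarrow> real \<Rightarrow> real" where
  "prim F f = (SOME P. (\<forall>y. (P has_real_derivative f y) (at y)) \<and> (P \<longlongrightarrow> 0) F)"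

text \<open>Both E + P and E - P have nonnegative derivative and vanish at -infinity. An explicit
  primitive E of a majorant thus replaces every estimate of an improper integral.\<close>

lemma prim_bound_bot:
  assumes P: "\<And>y. (P has_real_derivative f y) (at y)" "(P \<longlongrightarrow> 0) at_bot"
    and E: "\<And>y. (E has_real_derivative e y) (at y)" "(E \<longlongrightarrow> 0) at_bot"
    and le: "\<And>y. \<bar>f y\<bar> \<le> e y"
  shows "\<bar>P y\<bar> \<le> E y"
proof -
  have pos: "0 \<le> e y + f y" "0 \<le> e y - f y" "0 \<le> e y" for y using le[of y] by linarith+
  have "mono (\<lambda>y. E y + P y)"
    by (rule DERIV_mono, rule DERIV_add[OF E(1) P(1)], rule pos)
  then have 1: "0 \<le> E y + P y"
    using mono_tendsto_at_bot_ge[of _ "0 + 0"] tendsto_add[OF E(2) P(2)] by fastforce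
  have "mono (\<lambda>y. E y - P y)"
    by (rule DERIV_mono, rule DERIV_diff[OF E(1) P(1)], rule pos)
  then have "0 \<le> E y - P y"
    using mono_tendsto_at_bot_ge[of _ "0 - 0"] tendsto_diff[OF E(2) P(2)] by fastforce
  with 1 show ?thesis by linarith
qed

lemma prim_bot:
  assumes f: "continuous_on UNIV f"
    and E: "\<And>y. (E has_real_derivative e y) (at y)" "(E \<longlongrightarrow> 0) at_bot"
    and le: "\<And>y. \<bar>f y\<bar> \<le> e y"
  shows "(prim at_bot f has_real_derivative f y) (at y)" "(prim at_bot f \<longlongrightarrow> 0) at_bot"
proof -
  have pos: "0 \<le> e y + f y" "0 \<le> e y - f y" "0 \<le> e y" for y using le[of y] by linarith+
  obtain P where P: "\<And>x. (P has_real_derivative f x) (at x)"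
    using antiderivative_exists[OF f] by blast
  have m1: "mono (\<lambda>y. E y + P y)"
    by (rule DERIV_mono, rule DERIV_add[OF E(1) P(1)], rule pos)
  have m2: "mono (\<lambda>y. E y - P y)"
    by (rule DERIV_mono, rule DERIV_diff[OF E(1) P(1)], rule pos)
  have m3: "mono E"
    by (rule DERIV_mono, rule E(1), rule pos)
  have E0: "0 \<le> E y" for y using mono_tendsto_at_bot_ge[OF m3 E(2)] .
  \<comment> \<open>To the left of 0, monotonicity of E - P gives P y - E y >= P 0 - E 0, and E >= 0
    turns this into a lower bound of E + P. This keeps the increasing function E + P from running
    off to -infinity.\<close>
  have lower: "min (E 0 + P 0) (P 0 - E 0) \<le> E y + P y" for y
  proof (cases "0 \<le> y")
    case True then show ?thesis using monoD[OF m1, of 0 y] by auto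
  next
    case False then show ?thesis using monoD[OF m2, of y 0] E0[of y] by auto
  qed
  obtain L where "((\<lambda>y. E y + P y) \<longlongrightarrow> L) at_bot"
    using mono_tendsto_at_bot[OF m1 lower] by blast
  from tendsto_diff[OF this E(2)] have L: "(P \<longlongrightarrow> L) at_bot" by simp
  have "\<exists>P. (\<forall>y. (P has_real_derivative f y) (at y)) \<and> (P \<longlongrightarrow> 0) at_bot"
  proof (intro exI conjI allI)
    show "((\<lambda>y. P y - L) has_real_derivative f y) (at y)" for y
      by (auto intro!: derivative_eq_intros P)
    show "((\<lambda>y. P y - L) \<longlongrightarrow> 0) at_bot" using tendsto_diff[OF L tendsto_const[of L]] by simp
  qed
  then have *: "(\<forall>y. (prim at_bot f has_real_derivative f y) (at y)) \<and> (prim at_bot f \<longlongrightarrow> 0) at_bot"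
    unfolding prim_def by (rule someI_ex)
  show "(prim at_bot f has_real_derivative f y) (at y)" by (rule *[THEN conjunct1, rule_format])
  show "(prim at_bot f \<longlongrightarrow> 0) at_bot" by (rule *[THEN conjunct2])
qed

lemma DERIV_reflect:
  fixes P :: "real \<Rightarrow> real"
  assumes "\<And>y. (P has_real_derivative f y) (at y)"
  shows "((\<lambda>y. P (- y)) has_real_derivative - f (- y)) (at y)"
  using DERIV_chain2[OF assms[of "-y"] DERIV_minus[OF DERIV_ident]] by simp

lemma prim_bound_top:
  assumes P: "\<And>y. (P has_real_derivative f y) (at y)" "(P \<longlongrightarrow> 0) at_top"
    and E: "\<And>y. (E has_real_derivative - e y) (at y)" "(E \<longlongrightarrow> 0) at_top"
    and le: "\<And>y. \<bar>f y\<bar> \<le> e y"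
  shows "\<bar>P y\<bar> \<le> E y"
proof -
  have "\<bar>P (- (- y))\<bar> \<le> E (- (- y))"
    by (rule prim_bound_bot[of "\<lambda>y. P (- y)" "\<lambda>y. - f (- y)" "\<lambda>y. E (- y)" "\<lambda>y. e (- y)" "- y"])
       (use DERIV_reflect[OF P(1)] DERIV_reflect[OF E(1)] P(2) E(2) le
        in \<open>auto simp: filterlim_at_bot_mirror\<close>)
  then show ?thesis by simp
qed

lemma prim_top:
  assumes f: "continuous_on UNIV f"
    and E: "\<And>y. (E has_real_derivative - e y) (at y)" "(E \<longlongrightarrow> 0) at_top"
    and le: "\<And>y. \<bar>f y\<bar> \<le> e y"
  shows "(prim at_top f has_real_derivative f y) (at y)" "(prim at_top f \<longlongrightarrow> 0) at_top"
proof -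
  have c: "continuous_on UNIV (\<lambda>y. f (- y))"
    by (intro continuous_on_compose2[OF f] continuous_intros) auto
  note * = prim_bot[OF c, of "\<lambda>y. E (- y)" "\<lambda>y. e (- y)"]
  have 1: "((\<lambda>y. E (- y)) has_real_derivative e (- y)) (at y)" for y
    using DERIV_reflect[OF E(1)] by simp
  have 2: "((\<lambda>y. E (- y)) \<longlongrightarrow> 0) at_bot" using E(2) by (simp add: filterlim_at_bot_mirror)
  let ?P = "prim at_bot (\<lambda>y. f (- y))"
  have "\<exists>P. (\<forall>y. (P has_real_derivative f y) (at y)) \<and> (P \<longlongrightarrow> 0) at_top"
  proof (intro exI conjI allI)
    show "((\<lambda>y. - ?P (- y)) has_real_derivative f y) (at y)" for y
      using DERIV_minus[OF DERIV_reflect[OF *(1)[OF 1 2]]] le by simp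
    show "((\<lambda>y. - ?P (- y)) \<longlongrightarrow> 0) at_top"
      using tendsto_minus[OF *(2)[OF 1 2]] le by (simp add: filterlim_at_bot_mirror)
  qed
  then have *: "(\<forall>y. (prim at_top f has_real_derivative f y) (at y)) \<and> (prim at_top f \<longlongrightarrow> 0) at_top"
    unfolding prim_def by (rule someI_ex)
  show "(prim at_top f has_real_derivative f y) (at y)" by (rule *[THEN conjunct1, rule_format])
  show "(prim at_top f \<longlongrightarrow> 0) at_top" by (rule *[THEN conjunct2])
qed

definition bounded_sol :: "(real \<Rightarrow> real) \<Rightarrow> (real \<Rightarrow> real) \<Rightarrow> real \<Rightarrow> real" where
  "bounded_sol c f = (SOME z. (\<forall>y. (z has_real_derivative c y * (z y - f y)) (at y)) \<and> bounded (range z))"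

text \<open>A maximum principle from +infinity: if w solves the equation and its source is at most
  K, then exp (- C) (w - K) is increasing and tends to 0 because w is bounded, hence is never
  positive. Applied to shifts and to differences of solutions it yields closeness to a constant and
  Lipschitz bounds with constant 1.\<close>

lemma bounded_sol_bound:
  assumes z: "\<And>y. (z has_real_derivative c y * (z y - f y)) (at y)" "bounded (range z)"
    and C: "\<And>y. (C has_real_derivative c y) (at y)" "filterlim C at_top at_top" "\<And>y. 0 \<le> c y"
    and f: "\<And>y. \<bar>f y\<bar> \<le> K"
  shows "\<bar>z y\<bar> \<le> K"
proof -
  have lim: "((\<lambda>y. exp (- C y)) \<longlongrightarrow> 0) at_top"
    using C(2) by (intro filterlim_compose[OF exp_at_bot] filterlim_compose[OF filterlim_uminus_at_bot_at_top])
  have key: "w y \<le> K" if w: "\<And>y. (w has_real_derivative c y * (w y - g y)) (at y)" "bounded (range w)"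
    and g: "\<And>y. \<bar>g y\<bar> \<le> K" for w g :: "real \<Rightarrow> real"
  proof -
    obtain B where B: "\<And>y. \<bar>w y - K\<bar> \<le> B"
    proof -
      obtain B where "\<And>y. norm (w y) \<le> B" using w(2) unfolding bounded_iff by auto
      then have "\<bar>w y - K\<bar> \<le> B + \<bar>K\<bar>" for y
        using abs_triangle_ineq4[of "w y" K] by (metis add_right_mono order_trans real_norm_def)
      then show ?thesis using that by blast
    qed
    let ?p = "\<lambda>y. exp (- C y) * (w y - K)"
    have "((\<lambda>y. exp (- C y) * B) \<longlongrightarrow> 0) at_top"
      using tendsto_mult_right[OF lim] by simp
    then have p0: "(?p \<longlongrightarrow> 0) at_top"
      by (rule Lim_null_comparison[rotated]) (use B in \<open>auto simp: abs_mult intro!: always_eventually mult_left_mono\<close>)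
    have d: "(?p has_real_derivative exp (- C y) * (c y * (K - g y))) (at y)" for y
      by (auto intro!: derivative_eq_intros w C simp: algebra_simps)
    have "mono ?p"
      by (rule DERIV_mono[OF d]) (use C(3) g[THEN abs_le_D1] in \<open>simp add: mult_nonneg_nonneg\<close>)
    then have "?p y \<le> 0"
      by (intro tendsto_lowerbound[OF p0])
         (auto simp: eventually_at_top_linorder intro!: exI[of _ y] dest: monoD)
    then show ?thesis by (simp add: mult_le_0_iff)
  qed
  have "z y \<le> K" by (rule key[OF z f])
  moreover have "- z y \<le> K"
  proof (rule key[of "\<lambda>y. - z y" "\<lambda>y. - f y"])
    show "((\<lambda>y. - z y) has_real_derivative c y * (- z y - - f y)) (at y)" for y
      using DERIV_minus[OF z(1)] by (simp add: algebra_simps)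
    show "bounded (range (\<lambda>y. - z y))" using z(2) by (auto simp: bounded_iff)
  qed (use f in simp)
  ultimately show ?thesis by linarith
qed

text \<open>Variation of constants started at +infinity: z y is exp (C y) times the integral of exp
  (- C) c f over (y, infinity). The weight exp (- C) c has primitive - exp (- C), so z is an average
  of the values of f to the right of y.\<close>

lemma bounded_sol:
  assumes C: "\<And>y. (C has_real_derivative c y) (at y)" "filterlim C at_top at_top" "\<And>y. 0 \<le> c y"
    and c: "continuous_on UNIV c"
    and f: "continuous_on UNIV f" "\<And>y. \<bar>f y\<bar> \<le> K"
  shows "(bounded_sol c f has_real_derivative c y * (bounded_sol c f y - f y)) (at y)" "bounded (range (bounded_sol c f))"
proof -
  have lim: "((\<lambda>y. exp (- C y)) \<longlongrightarrow> 0) at_top"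
    using C(2) by (intro filterlim_compose[OF exp_at_bot] filterlim_compose[OF filterlim_uminus_at_bot_at_top])
  have cC: "continuous_on UNIV C" by (rule DERIV_continuous_on[OF has_field_derivative_at_within[OF C(1)]])
  let ?g = "\<lambda>y. - (exp (- C y) * c y * f y)" and ?E = "\<lambda>y. K * exp (- C y)" and ?e = "\<lambda>y. K * (exp (- C y) * c y)"
  have g: "continuous_on UNIV ?g" by (intro continuous_intros f c cC)
  have E: "(?E has_real_derivative - ?e y) (at y)" for y
    by (auto intro!: derivative_eq_intros C)
  have E0: "(?E \<longlongrightarrow> 0) at_top" using tendsto_mult_left[OF lim] by simp
  have le: "\<bar>?g y\<bar> \<le> ?e y" for y
    using mult_right_mono[OF f(2)[of y], of "exp (- C y) * c y"] C(3)[of y] by (simp add: abs_mult mult_ac)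
  note P = prim_top[OF g E E0 le]
  let ?P = "prim at_top ?g"
  have "\<exists>z. (\<forall>y. (z has_real_derivative c y * (z y - f y)) (at y)) \<and> bounded (range z)"
  proof (intro exI conjI allI)
    show "((\<lambda>y. exp (C y) * ?P y) has_real_derivative c y * (exp (C y) * ?P y - f y)) (at y)" for y
    proof -
      have "exp (C y) * exp (- C y) = 1" by (simp flip: exp_add)
      then have *: "exp (C y) * - (exp (- C y) * c y * f y) = - (c y * f y)"
        by (simp only: mult_minus_right mult.assoc[symmetric] mult_1_left)
      have "((\<lambda>y. exp (C y) * ?P y) has_real_derivative
          exp (C y) * c y * ?P y + ?g y * exp (C y)) (at y)"
        by (rule DERIV_mult[OF DERIV_chain2[OF DERIV_exp C(1)] P(1)])
      moreover have "exp (C y) * c y * ?P y + ?g y * exp (C y) = c y * (exp (C y) * ?P y - f y)"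
        using * by (simp only: mult.commute[of "?g y"]) (simp add: right_diff_distrib mult_ac)
      ultimately show ?thesis by (simp only:)
    qed
    have "\<bar>exp (C y) * ?P y\<bar> \<le> K" for y
    proof -
      have "exp (C y) * exp (- C y) = 1" by (simp flip: exp_add)
      have "\<bar>?P y\<bar> \<le> ?E y" by (rule prim_bound_top[OF P E E0 le])
      then have "exp (C y) * \<bar>?P y\<bar> \<le> exp (C y) * ?E y" by simp
      also have "\<dots> = K" using \<open>exp (C y) * exp (- C y) = 1\<close>
        by (simp add: mult.left_commute)
      finally show ?thesis by (simp add: abs_mult)
    qed
    then show "bounded (range (\<lambda>y. exp (C y) * ?P y))" by (auto simp: bounded_iff)
  qed
  then have *: "(\<forall>y. (bounded_sol c f has_real_derivative c y * (bounded_sol c f y - f y)) (at y)) \<and> bounded (range (bounded_sol c f))"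
    unfolding bounded_sol_def by (rule someI_ex)
  show "(bounded_sol c f has_real_derivative c y * (bounded_sol c f y - f y)) (at y)" by (rule *[THEN conjunct1, rule_format])
  show "bounded (range (bounded_sol c f))" by (rule *[THEN conjunct2])
qed

section \<open>Averages over logistic time\<close>

definition lg :: "real \<Rightarrow> real" where "lg y = 1 / (1 + exp (- y))"

lemma lg_pos: "0 < lg y" and lg_less_1: "lg y < 1"
  by (simp_all add: lg_def add_pos_pos)

lemma lg_bounds [simp]: "0 \<le> lg y" "lg y \<le> 1" "lg y \<noteq> 0" "1 - lg y \<noteq> 0"
  using lg_pos[of y] lg_less_1[of y] by auto

lemma DERIV_lg: "(lg has_real_derivative lg y * (1 - lg y)) (at y)"
proof -
  have "1 + exp (- y) > 0" by (simp add: add_pos_pos)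
  then show ?thesis
    unfolding lg_def[abs_def]
    by (auto intro!: derivative_eq_intros simp: field_simps power2_eq_square)
qed

lemma lg_at_bot: "(lg \<longlongrightarrow> 0) at_bot"
  unfolding lg_def[abs_def]
  by (rule tendsto_divide_0[OF tendsto_const])
     (intro filterlim_at_top_imp_at_infinity filterlim_tendsto_add_at_top[OF tendsto_const]
        filterlim_compose[OF exp_at_top] filterlim_uminus_at_top_at_bot)

lemma lg_at_top: "(lg \<longlongrightarrow> 1) at_top"
proof -
  have "((\<lambda>y::real. 1 / (1 + exp (- y))) \<longlongrightarrow> 1 / (1 + 0)) at_top"
    by (rule tendsto_divide[OF tendsto_const tendsto_add[OF tendsto_const
          filterlim_compose[OF exp_at_bot filterlim_uminus_at_bot_at_top]]]) simp
  then show ?thesis by (simp add: lg_def[abs_def])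
qed

lemma continuous_lg [continuous_intros]: "continuous_on A lg"
  by (rule DERIV_continuous_on[OF has_field_derivative_at_within[OF DERIV_lg]])

text \<open>This is ds/dy for s = \<open>lg y\<close>, the density that turns integrals in s into
  integrals in y.\<close>

definition slope :: "real \<Rightarrow> real" where "slope y = lg y * (1 - lg y)"

lemma slope_pos: "0 < slope y"
  using lg_pos lg_less_1 by (simp add: slope_def)

definition bounded_cont :: "(real \<Rightarrow> real) \<Rightarrow> bool" where
  "bounded_cont u \<longleftrightarrow> continuous_on UNIV u \<and> (\<exists>K. \<forall>y. \<bar>u y\<bar> \<le> K)"

text \<open>Written in s: \<open>cum\<close> is the integral of u over (0, s), \<open>tail\<close>
  is minus the integral over (s, 1), \<open>mom0\<close> integrates r u(r) over (0, s), and
  \<open>mom1\<close> integrates (1 - r) u(r) over (s, 1). The two moments are the halves of Green's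
  function of -g'' on (0, 1) with zero boundary values.\<close>

definition cum :: "(real \<Rightarrow> real) \<Rightarrow> real \<Rightarrow> real" where
  "cum u = prim at_bot (\<lambda>y. slope y * u y)"
definition tail :: "(real \<Rightarrow> real) \<Rightarrow> real \<Rightarrow> real" where
  "tail u = prim at_top (\<lambda>y. slope y * u y)"
definition mom0 :: "(real \<Rightarrow> real) \<Rightarrow> real \<Rightarrow> real" where
  "mom0 u = prim at_bot (\<lambda>y. lg y * slope y * u y)"
definition mom1 :: "(real \<Rightarrow> real) \<Rightarrow> real \<Rightarrow> real" where
  "mom1 u = prim at_top (\<lambda>y. - ((1 - lg y) * slope y * u y))"

text \<open>The bound is stated for any primitive P and not only for \<open>cum u\<close>, so that
  it applies to differences of two such integrals and to their deviation from an explicit formula.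
  The same form recurs for the moments.\<close>

lemma
  shows cum_bound_gen: "\<lbrakk>\<And>y. (P has_real_derivative slope y * u y) (at y); (P \<longlongrightarrow> 0) at_bot; \<And>y. \<bar>u y\<bar> \<le> K\<rbrakk>
      \<Longrightarrow> \<bar>P y\<bar> \<le> K * lg y"
    and DERIV_cum: "bounded_cont u \<Longrightarrow> (cum u has_real_derivative slope y * u y) (at y)"
    and cum_at_bot: "bounded_cont u \<Longrightarrow> (cum u \<longlongrightarrow> 0) at_bot"
proof -
  have E: "((\<lambda>y. K * lg y) has_real_derivative K * slope y) (at y)" for y K
    by (auto intro!: derivative_eq_intros DERIV_lg simp: slope_def)
  have E0: "((\<lambda>y. K * lg y) \<longlongrightarrow> 0) at_bot" for K
    using tendsto_mult_left[OF lg_at_bot] by simp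
  have le: "\<bar>slope y * u y\<bar> \<le> K * slope y" if "\<And>y. \<bar>u y\<bar> \<le> K" for y K
    using mult_right_mono[OF that[of y], of "slope y"] slope_pos[of y] by (simp add: abs_mult mult_ac)
  show "\<bar>P y\<bar> \<le> K * lg y" if "\<And>y. (P has_real_derivative slope y * u y) (at y)" "(P \<longlongrightarrow> 0) at_bot" "\<And>y. \<bar>u y\<bar> \<le> K"
    by (rule prim_bound_bot[OF that(1,2) E E0 le[OF that(3)]])
  assume "bounded_cont u"
  then obtain K where u: "continuous_on UNIV u" "\<And>y. \<bar>u y\<bar> \<le> K" unfolding bounded_cont_def by auto
  have c: "continuous_on UNIV (\<lambda>y. slope y * u y)"
    unfolding slope_def by (intro continuous_intros u)
  show "(cum u has_real_derivative slope y * u y) (at y)" "(cum u \<longlongrightarrow> 0) at_bot"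
    unfolding cum_def using prim_bot[OF c E E0 le[OF u(2)]] by auto
qed

lemma
  assumes "bounded_cont u"
  shows DERIV_tail: "(tail u has_real_derivative slope y * u y) (at y)"
    and tail_at_top: "(tail u \<longlongrightarrow> 0) at_top"
proof -
  obtain K where u: "continuous_on UNIV u" "\<And>y. \<bar>u y\<bar> \<le> K" using assms unfolding bounded_cont_def by auto
  have E: "((\<lambda>y. K * (1 - lg y)) has_real_derivative - (K * slope y)) (at y)" for y
    by (auto intro!: derivative_eq_intros DERIV_lg simp: slope_def)
  have E0: "((\<lambda>y. K * (1 - lg y)) \<longlongrightarrow> 0) at_top"
    using tendsto_mult_left[OF tendsto_diff[OF tendsto_const[of 1] lg_at_top]] by simp
  have le: "\<bar>slope y * u y\<bar> \<le> K * slope y" for y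
    using mult_right_mono[OF u(2)[of y], of "slope y"] slope_pos[of y] by (simp add: abs_mult mult_ac)
  have c: "continuous_on UNIV (\<lambda>y. slope y * u y)"
    unfolding slope_def by (intro continuous_intros u)
  show "(tail u has_real_derivative slope y * u y) (at y)" "(tail u \<longlongrightarrow> 0) at_top"
    unfolding tail_def using prim_top[OF c E E0 le] by auto
qed

lemma
  shows mom0_bound_gen: "\<lbrakk>\<And>y. (P has_real_derivative lg y * slope y * u y) (at y); (P \<longlongrightarrow> 0) at_bot; \<And>y. \<bar>u y\<bar> \<le> K\<rbrakk>
      \<Longrightarrow> \<bar>P y\<bar> \<le> K * (lg y)\<^sup>2 / 2"
    and DERIV_mom0: "bounded_cont u \<Longrightarrow> (mom0 u has_real_derivative lg y * slope y * u y) (at y)"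
    and mom0_at_bot: "bounded_cont u \<Longrightarrow> (mom0 u \<longlongrightarrow> 0) at_bot"
proof -
  have E: "((\<lambda>y. K * (lg y)\<^sup>2 / 2) has_real_derivative K * (lg y * slope y)) (at y)" for y K
    by (auto intro!: derivative_eq_intros DERIV_lg simp: slope_def)
  have E0: "((\<lambda>y. K * (lg y)\<^sup>2 / 2) \<longlongrightarrow> 0) at_bot" for K
    using tendsto_mult_left[OF tendsto_power[OF lg_at_bot, of 2], of "K/2"] by simp
  have le: "\<bar>lg y * slope y * u y\<bar> \<le> K * (lg y * slope y)" if "\<And>y. \<bar>u y\<bar> \<le> K" for y K
    using mult_right_mono[OF that[of y], of "lg y * slope y"] slope_pos[of y] by (simp add: abs_mult mult_ac)
  show "\<bar>P y\<bar> \<le> K * (lg y)\<^sup>2 / 2" if "\<And>y. (P has_real_derivative lg y * slope y * u y) (at y)" "(P \<longlongrightarrow> 0) at_bot" "\<And>y. \<bar>u y\<bar> \<le> K"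
    by (rule prim_bound_bot[OF that(1,2) E E0 le[OF that(3)]])
  assume "bounded_cont u"
  then obtain K where u: "continuous_on UNIV u" "\<And>y. \<bar>u y\<bar> \<le> K" unfolding bounded_cont_def by auto
  have c: "continuous_on UNIV (\<lambda>y. lg y * slope y * u y)"
    unfolding slope_def by (intro continuous_intros u)
  show "(mom0 u has_real_derivative lg y * slope y * u y) (at y)" "(mom0 u \<longlongrightarrow> 0) at_bot"
    unfolding mom0_def using prim_bot[OF c E E0 le[OF u(2)]] by auto
qed

lemma
  shows mom1_bound_gen: "\<lbrakk>\<And>y. (P has_real_derivative - ((1 - lg y) * slope y * u y)) (at y); (P \<longlongrightarrow> 0) at_top; \<And>y. \<bar>u y\<bar> \<le> K\<rbrakk>
      \<Longrightarrow> \<bar>P y\<bar> \<le> K * (1 - lg y)\<^sup>2 / 2"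
    and DERIV_mom1: "bounded_cont u \<Longrightarrow> (mom1 u has_real_derivative - ((1 - lg y) * slope y * u y)) (at y)"
    and mom1_at_top: "bounded_cont u \<Longrightarrow> (mom1 u \<longlongrightarrow> 0) at_top"
proof -
  have E: "((\<lambda>y. K * (1 - lg y)\<^sup>2 / 2) has_real_derivative - (K * ((1 - lg y) * slope y))) (at y)" for y K
    by (auto intro!: derivative_eq_intros DERIV_lg simp: slope_def)
  have E0: "((\<lambda>y. K * (1 - lg y)\<^sup>2 / 2) \<longlongrightarrow> 0) at_top" for K
    using tendsto_mult_left[OF tendsto_power[OF tendsto_diff[OF tendsto_const[of 1] lg_at_top], of 2], of "K/2"] by simp
  have le: "\<bar>- ((1 - lg y) * slope y * u y)\<bar> \<le> K * ((1 - lg y) * slope y)" if "\<And>y. \<bar>u y\<bar> \<le> K" for y K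
    using mult_right_mono[OF that[of y], of "(1 - lg y) * slope y"] slope_pos[of y] by (simp add: abs_mult mult_ac)
  show "\<bar>P y\<bar> \<le> K * (1 - lg y)\<^sup>2 / 2" if "\<And>y. (P has_real_derivative - ((1 - lg y) * slope y * u y)) (at y)" "(P \<longlongrightarrow> 0) at_top" "\<And>y. \<bar>u y\<bar> \<le> K"
    by (rule prim_bound_top[OF that(1,2) E E0 le[OF that(3)]])
  assume "bounded_cont u"
  then obtain K where u: "continuous_on UNIV u" "\<And>y. \<bar>u y\<bar> \<le> K" unfolding bounded_cont_def by auto
  have c: "continuous_on UNIV (\<lambda>y. - ((1 - lg y) * slope y * u y))"
    unfolding slope_def by (intro continuous_intros u)
  show "(mom1 u has_real_derivative - ((1 - lg y) * slope y * u y)) (at y)" "(mom1 u \<longlongrightarrow> 0) at_top"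
    unfolding mom1_def using prim_top[OF c E E0 le[OF u(2)]] by auto
qed

lemma
  assumes u: "bounded_cont u" and v: "bounded_cont v" and d: "\<And>y. \<bar>u y - v y\<bar> \<le> d"
  shows cum_diff: "\<bar>cum u y - cum v y\<bar> \<le> d * lg y"
    and mom0_diff: "\<bar>mom0 u y - mom0 v y\<bar> \<le> d * (lg y)\<^sup>2 / 2"
    and mom1_diff: "\<bar>mom1 u y - mom1 v y\<bar> \<le> d * (1 - lg y)\<^sup>2 / 2"
proof -
  show "\<bar>cum u y - cum v y\<bar> \<le> d * lg y"
    by (rule cum_bound_gen[of _ "\<lambda>y. u y - v y"], unfold right_diff_distrib,
        rule DERIV_diff[OF DERIV_cum[OF u] DERIV_cum[OF v]])
       (use tendsto_diff[OF cum_at_bot[OF u] cum_at_bot[OF v]] d in auto)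
  show "\<bar>mom0 u y - mom0 v y\<bar> \<le> d * (lg y)\<^sup>2 / 2"
    by (rule mom0_bound_gen[of _ "\<lambda>y. u y - v y"], unfold right_diff_distrib,
        rule DERIV_diff[OF DERIV_mom0[OF u] DERIV_mom0[OF v]])
       (use tendsto_diff[OF mom0_at_bot[OF u] mom0_at_bot[OF v]] d in auto)
  have "((\<lambda>y. mom1 u y - mom1 v y) has_real_derivative - ((1 - lg y) * slope y * (u y - v y))) (at y)" for y
    using DERIV_diff[OF DERIV_mom1[OF u, of y] DERIV_mom1[OF v, of y]]
    by (simp add: algebra_simps)
  then show "\<bar>mom1 u y - mom1 v y\<bar> \<le> d * (1 - lg y)\<^sup>2 / 2"
    by (rule mom1_bound_gen[of _ "\<lambda>y. u y - v y"])
       (use tendsto_diff[OF mom1_at_top[OF u] mom1_at_top[OF v]] d in auto)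
qed

text \<open>
  In the variable \<open>s = lg y\<close> put g = G / M, M = W_1(+infinity). Then theta = M \<open>cum u\<close>, and g solves g'' = -M u with
  g(0) = g(1) = 0 and g'(0) = 1. Splitting Green's function of this problem at s gives
  g = M s (1 - s) \<open>avgH u\<close> / 2, and g'(0) = 1 becomes 1 / M = \<open>avgN u\<close> / 2.
  All three averages have norm 1 and preserve constants.
\<close>
definition avgI :: "(real \<Rightarrow> real) \<Rightarrow> real \<Rightarrow> real" where
  "avgI u y = cum u y / lg y"
definition avgH :: "(real \<Rightarrow> real) \<Rightarrow> real \<Rightarrow> real" where
  "avgH u y = 2 * mom0 u y / lg y + 2 * mom1 u y / (1 - lg y)"
definition avgN :: "(real \<Rightarrow> real) \<Rightarrow> real" where
  "avgN u = 2 * (cum u 0 + mom1 u 0 - mom0 u 0)"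
text \<open>The integral of u over 0 < s < 1, cut at y = 0 so that no limit enters the
  definition.\<close>

definition total :: "(real \<Rightarrow> real) \<Rightarrow> real" where
  "total u = cum u 0 - tail u 0"

text \<open>\<open>avgN u\<close> is twice the integral of (1 - s) u over (0, 1), cut at an
  arbitrary point; the densities cancel since 1 - (1 - s) - s = 0. The free cut is used with y ->
  -infinity for the norm, and at the current y for the derivative of G.\<close>

lemma avgN_eq:
  assumes "bounded_cont u"
  shows "avgN u = 2 * (cum u y + mom1 u y - mom0 u y)"
proof -
  have "((\<lambda>y. cum u y + mom1 u y - mom0 u y) has_real_derivative 0) (at y)" for y
    using DERIV_diff[OF DERIV_add[OF DERIV_cum[OF assms, of y] DERIV_mom1[OF assms, of y]] DERIV_mom0[OF assms, of y]]
    by (simp add: algebra_simps)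
  then show ?thesis unfolding avgN_def using DERIV_isconst_all by (metis (no_types, lifting))
qed

lemma total_limit:
  assumes "bounded_cont u"
  shows "(cum u \<longlongrightarrow> total u) at_top"
proof -
  have "((\<lambda>y. cum u y - tail u y) has_real_derivative 0) (at y)" for y
    using DERIV_diff[OF DERIV_cum[OF assms, of y] DERIV_tail[OF assms, of y]] by simp
  then have "cum u y - tail u y = total u" for y
    unfolding total_def using DERIV_isconst_all by (metis (no_types, lifting))
  then have "cum u = (\<lambda>y. total u + tail u y)" by (auto simp: algebra_simps fun_eq_iff)
  moreover have "((\<lambda>y. total u + tail u y) \<longlongrightarrow> total u + 0) at_top"
    by (intro tendsto_intros tail_at_top assms)
  ultimately show ?thesis by simp
qed

text \<open>For \<open>avgH\<close> the two moments contribute at most d s and d (1 - s), which add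
  up to exactly d. Constant 1 in all of these bounds is what leaves room for the
  contraction.\<close>

lemma
  assumes u: "bounded_cont u" and v: "bounded_cont v" and d: "\<And>y. \<bar>u y - v y\<bar> \<le> d"
  shows avgI_diff: "\<bar>avgI u y - avgI v y\<bar> \<le> d"
    and avgH_diff: "\<bar>avgH u y - avgH v y\<bar> \<le> d"
    and avgN_diff: "\<bar>avgN u - avgN v\<bar> \<le> d"
    and total_diff: "\<bar>total u - total v\<bar> \<le> d"
proof -
  note C = cum_diff[OF u v d] and M0 = mom0_diff[OF u v d] and M1 = mom1_diff[OF u v d]
  show "\<bar>avgI u y - avgI v y\<bar> \<le> d"
    using C[of y] lg_pos[of y]
    by (simp add: avgI_def abs_divide pos_divide_le_eq flip: diff_divide_distrib)
  have aux: "\<bar>2 * x / s\<bar> \<le> d * s" if "\<bar>x\<bar> \<le> d * s\<^sup>2 / 2" "0 < s" for x s :: real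
    using that by (simp add: abs_mult abs_divide pos_divide_le_eq power2_eq_square mult_ac)
  have 1: "\<bar>2 * (mom0 u y - mom0 v y) / lg y\<bar> \<le> d * lg y"
    by (rule aux[OF M0 lg_pos])
  have 2: "\<bar>2 * (mom1 u y - mom1 v y) / (1 - lg y)\<bar> \<le> d * (1 - lg y)"
    using lg_less_1[of y] by (intro aux[OF M1]) simp
  have "avgH u y - avgH v y = 2 * (mom0 u y - mom0 v y) / lg y + 2 * (mom1 u y - mom1 v y) / (1 - lg y)"
    by (simp add: avgH_def right_diff_distrib diff_divide_distrib)
  also have "\<bar>\<dots>\<bar> \<le> d * lg y + d * (1 - lg y)" using 1 2 by linarith
  finally show "\<bar>avgH u y - avgH v y\<bar> \<le> d" by (simp add: algebra_simps)
  have N: "\<bar>avgN u - avgN v\<bar> \<le> 2 * (d * lg y) + d * (1 - lg y)\<^sup>2 + d * (lg y)\<^sup>2" for y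
  proof -
    have aux: "\<bar>2 * (a + b - c) - 2 * (a' + b' - c')\<bar> \<le> 2 * p + q + r"
      if "\<bar>a - a'\<bar> \<le> p" "\<bar>b - b'\<bar> \<le> q / 2" "\<bar>c - c'\<bar> \<le> r / 2" for a b c a' b' c' p q r :: real
      using that by argo
    show ?thesis unfolding avgN_eq[OF u, of y] avgN_eq[OF v, of y] by (rule aux[OF C M1 M0])
  qed
  \<comment> \<open>At a finite cut the three pieces bound the difference by more than d; as the cut
    moves to s = 0 only \<open>mom1\<close> survives and the bound becomes d.\<close>
  have "((\<lambda>y. 2 * (d * lg y) + d * (1 - lg y)\<^sup>2 + d * (lg y)\<^sup>2) \<longlongrightarrow> 2 * (d * 0) + d * (1 - 0)\<^sup>2 + d * 0\<^sup>2) at_bot"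
    by (intro tendsto_intros lg_at_bot)
  from tendsto_lowerbound[OF this, of "\<bar>avgN u - avgN v\<bar>"] N show "\<bar>avgN u - avgN v\<bar> \<le> d" by simp
  have d0: "0 \<le> d" using d[of 0] by linarith
  have "\<bar>cum u y - cum v y\<bar> \<le> d" for y
    using C[of y] mult_left_mono[OF lg_bounds(2)[of y] d0] by linarith
  then show "\<bar>total u - total v\<bar> \<le> d"
    by (intro tendsto_upperbound[OF tendsto_rabs[OF tendsto_diff[OF total_limit[OF u] total_limit[OF v]]]]) auto
qed

lemma
  shows avgI_const: "avgI (\<lambda>_. c) y = c"
    and avgH_const: "avgH (\<lambda>_. c) y = c"
    and avgN_const: "avgN (\<lambda>_. c) = c"
    and total_const: "total (\<lambda>_. c) = c"
proof -
  have b: "bounded_cont (\<lambda>_. c)" by (auto simp: bounded_cont_def)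
  \<comment> \<open>A primitive of 0 that vanishes at -infinity is 0: the general bound with K = 0
    serves as the uniqueness statement.\<close>
  have "\<bar>cum (\<lambda>_. c) y - c * lg y\<bar> \<le> 0 * lg y" for y
    by (rule cum_bound_gen[of _ "\<lambda>_. 0"])
       (use tendsto_diff[OF cum_at_bot[OF b] tendsto_mult_left[OF lg_at_bot, of c]] in
         \<open>auto intro!: derivative_eq_intros DERIV_lg DERIV_cum[OF b] simp: slope_def\<close>)
  then have C: "cum (\<lambda>_. c) y = c * lg y" for y by simp
  have "\<bar>mom0 (\<lambda>_. c) y - c / 2 * (lg y)\<^sup>2\<bar> \<le> 0 * (lg y)\<^sup>2 / 2" for y
    by (rule mom0_bound_gen[of _ "\<lambda>_. 0"])
       (use tendsto_diff[OF mom0_at_bot[OF b] tendsto_mult_left[OF tendsto_power[OF lg_at_bot, of 2], of "c / 2"]] in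
         \<open>auto intro!: derivative_eq_intros DERIV_lg DERIV_mom0[OF b] simp: slope_def\<close>)
  then have M0: "mom0 (\<lambda>_. c) y = c / 2 * (lg y)\<^sup>2" for y by simp
  have "\<bar>mom1 (\<lambda>_. c) y - c / 2 * (1 - lg y)\<^sup>2\<bar> \<le> 0 * (1 - lg y)\<^sup>2 / 2" for y
    by (rule mom1_bound_gen[of _ "\<lambda>_. 0"])
       (use tendsto_diff[OF mom1_at_top[OF b] tendsto_mult_left[OF tendsto_power[OF
              tendsto_diff[OF tendsto_const[of 1] lg_at_top], of 2], of "c / 2"]] in
         \<open>auto intro!: derivative_eq_intros DERIV_lg DERIV_mom1[OF b] simp: slope_def\<close>)
  then have M1: "mom1 (\<lambda>_. c) y = c / 2 * (1 - lg y)\<^sup>2" for y by simp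
  show "avgI (\<lambda>_. c) y = c" by (simp add: avgI_def C)
  show "avgH (\<lambda>_. c) y = c" by (simp add: avgH_def M0 M1 power2_eq_square) (simp add: algebra_simps)
  show "avgN (\<lambda>_. c) = c" by (simp add: avgN_def C M0 M1 power2_eq_square algebra_simps)
  have "(cum (\<lambda>_. c) \<longlongrightarrow> c) at_top"
    using tendsto_mult_left[OF lg_at_top, of c] by (simp add: C[abs_def])
  then show "total (\<lambda>_. c) = c"
    using tendsto_unique[OF _ total_limit[OF b]] by simp
qed

lemma
  assumes "bounded_cont u"
  shows continuous_avgI: "continuous_on UNIV (avgI u)"
    and continuous_avgH: "continuous_on UNIV (avgH u)"
proof -
  have [continuous_intros]: "continuous_on UNIV (cum u)" "continuous_on UNIV (mom0 u)" "continuous_on UNIV (mom1 u)"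
    by (rule DERIV_continuous_on[OF has_field_derivative_at_within], rule DERIV_cum DERIV_mom0 DERIV_mom1, rule assms)+
  show "continuous_on UNIV (avgI u)" "continuous_on UNIV (avgH u)"
    unfolding avgI_def[abs_def] avgH_def[abs_def] by (intro continuous_intros ballI lg_bounds)+
qed

section \<open>The contraction\<close>

text \<open>
  In logistic time y the equations for eta, alpha, beta are eta' = 4 s (eta - \<open>fE\<close>), alpha' = -kappa (alpha - \<open>fA\<close>)
  and beta' = kappa (beta - \<open>fA\<close>), the last with -1/kappa in place of 1/kappa; this is what \<open>fE\<close> and \<open>fA\<close>
  are solved for. The arguments are k = 1/kappa, s, and the averages i, h, n of u = (a + b) / 4.
\<close>
definition fE :: "real \<Rightarrow> real \<Rightarrow> real \<Rightarrow> real \<Rightarrow> real \<Rightarrow> real \<Rightarrow> real \<Rightarrow> real \<Rightarrow> real" where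
  "fE k s i h n a b e = (a + b) / 4 + (1 - i / h) * (e - (a + b) / 4)
     + (1 - s) / 4 * (k * ((a - b) * ((a + b) / 4 / n)))"

definition fA :: "real \<Rightarrow> real \<Rightarrow> real \<Rightarrow> real \<Rightarrow> real \<Rightarrow> real \<Rightarrow> real \<Rightarrow> real" where
  "fA k s i h n a e = (1 - e) + (1 - n / h) * (a - (1 - e)) - k * ((n / h - 2 * s * (i / h)) * a)"

section \<open>Size and Lipschitz estimates for the sources of the three equations\<close>

lemma prod_diff:
  fixes x1 x2 y1 y2 :: real
  assumes "\<bar>x1\<bar> \<le> X" "\<bar>y2\<bar> \<le> Y" "\<bar>x1 - x2\<bar> \<le> dx" "\<bar>y1 - y2\<bar> \<le> dy"
  shows "\<bar>x1 * y1 - x2 * y2\<bar> \<le> X * dy + Y * dx"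
proof -
  have "\<bar>x1 * y1 - x2 * y2\<bar> = \<bar>x1 * (y1 - y2) + (x1 - x2) * y2\<bar>" by (simp add: algebra_simps)
  also have "\<dots> \<le> \<bar>x1\<bar> * \<bar>y1 - y2\<bar> + \<bar>x1 - x2\<bar> * \<bar>y2\<bar>" by (metis abs_mult abs_triangle_ineq)
  also have "\<dots> \<le> X * dy + dx * Y"
    using assms by (intro add_mono mult_mono) auto
  finally show ?thesis by (simp add: mult.commute)
qed

lemma abs_prod_le:
  fixes x y :: real
  assumes "\<bar>x\<bar> \<le> X" "\<bar>y\<bar> \<le> Y"
  shows "\<bar>x * y\<bar> \<le> X * Y"
  unfolding abs_mult using assms by (intro mult_mono) auto

text \<open>Small enough that averages within this distance of 1/3 have quotients within 1/100 of 1;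
  the corrections in \<open>fE\<close> and \<open>fA\<close> are then minor compared with their
  leading terms.\<close>

abbreviation radius :: real where "radius \<equiv> 1 / 1000"

lemma quarter_near:
  fixes a b r :: real
  assumes "\<bar>a - 2/3\<bar> \<le> r" "\<bar>b - 2/3\<bar> \<le> r"
  shows "\<bar>(a + b) / 4 - 1/3\<bar> \<le> r / 2"
  using assms by argo

lemma quot_near:
  assumes "\<bar>i - 1/3\<bar> \<le> radius" "\<bar>h - 1/3\<bar> \<le> radius"
  shows "\<bar>1 - i / h\<bar> \<le> 1/100" "\<bar>i / h\<bar> \<le> 11/10"
proof -
  have h: "0 < h" "h \<ge> 33/100" using assms by (auto simp: abs_if split: if_splits)
  have "\<bar>h - i\<bar> \<le> h / 100" using assms h by (auto simp: abs_if split: if_splits)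
  moreover have "1 - i / h = (h - i) / h" using h by (simp add: diff_divide_distrib)
  ultimately show 1: "\<bar>1 - i / h\<bar> \<le> 1/100" using h by (simp add: abs_divide pos_divide_le_eq)
  then show "\<bar>i / h\<bar> \<le> 11/10" by linarith
qed

text \<open>The factor 36/100 exceeds sqrt 2 / 4, the Lipschitz constant of (a + b) / 4 in the
  Euclidean norm; averaging preserves it. Since h1 and h2 are about 1/3, the quotient costs a
  further factor of about 6, and 36/100 times 6 stays below 3.\<close>

lemma quot_diff:
  assumes "\<bar>i1 - 1/3\<bar> \<le> radius" "\<bar>i2 - 1/3\<bar> \<le> radius" "\<bar>h1 - 1/3\<bar> \<le> radius" "\<bar>h2 - 1/3\<bar> \<le> radius"
    and "\<bar>i1 - i2\<bar> \<le> 36/100 * d" "\<bar>h1 - h2\<bar> \<le> 36/100 * d"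
  shows "\<bar>i1 / h1 - i2 / h2\<bar> \<le> 3 * d"
proof -
  have h: "h1 \<ge> 33/100" "h2 \<ge> 33/100" "\<bar>h2\<bar> \<le> 34/100" "\<bar>i2\<bar> \<le> 34/100" and d: "0 \<le> d"
    using assms by linarith+
  have hh: "h1 * h2 \<ge> 1089/10000" using mult_mono[OF h(1,2)] h by simp
  have "i1 / h1 - i2 / h2 = (i1 * h2 - i2 * h1) / (h1 * h2)"
    using h by (simp add: field_simps)
  moreover have "\<bar>i1 * h2 - i2 * h1\<bar> \<le> (h1 * h2) * (3 * d)"
  proof -
    have "\<bar>i1 * h2 - i2 * h1\<bar> = \<bar>h2 * (i1 - i2) + i2 * (h2 - h1)\<bar>" by (simp add: algebra_simps)
    also have "\<dots> \<le> \<bar>h2 * (i1 - i2)\<bar> + \<bar>i2 * (h2 - h1)\<bar>" by (rule abs_triangle_ineq)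
    also have "\<dots> \<le> 34/100 * (36/100 * d) + 34/100 * (36/100 * d)"
      using assms h by (intro add_mono abs_prod_le) (auto simp: abs_minus_commute)
    also have "\<dots> \<le> 1089/10000 * (3 * d)" using d by simp
    also have "\<dots> \<le> (h1 * h2) * (3 * d)" using hh d by (intro mult_right_mono) auto
    finally show ?thesis .
  qed
  ultimately show ?thesis using hh by (simp add: abs_divide pos_divide_le_eq mult.commute)
qed

text \<open>The leading term (a + b) / 4 deviates by at most half the radius, so the other half can
  absorb both corrections. Hence the updated eta stays in the range where it may be inserted into
  the equations for alpha and beta.\<close>

lemma fE_near:
  assumes a: "\<bar>a - 2/3\<bar> \<le> radius" "\<bar>b - 2/3\<bar> \<le> radius" "\<bar>e - 1/3\<bar> \<le> radius"
    and i: "\<bar>i - 1/3\<bar> \<le> radius" "\<bar>h - 1/3\<bar> \<le> radius" "\<bar>n - 1/3\<bar> \<le> radius" and s: "0 \<le> s" "s \<le> 1" and k: "\<bar>k\<bar> \<le> radius"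
  shows "\<bar>fE k s i h n a b e - 1/3\<bar> \<le> radius"
proof -
  have u: "\<bar>(a + b) / 4 - 1/3\<bar> \<le> radius / 2" "\<bar>(a + b) / 4 - 1/3\<bar> \<le> radius"
    using quarter_near[OF a(1,2)] by auto
  have "\<bar>(1 - i / h) * (e - (a + b) / 4)\<bar> \<le> 1/100 * (2 * radius)"
    by (intro abs_prod_le quot_near i) (use a u in linarith)
  moreover have "\<bar>(1 - s) / 4 * (k * ((a - b) * ((a + b) / 4 / n)))\<bar> \<le> 1 * (radius * (2 * radius * (11/10)))"
    by (intro abs_prod_le k quot_near(2) u i) (use a(1,2) s in \<open>argo+\<close>)
  ultimately show ?thesis unfolding fE_def using u by linarith
qed

text \<open>A crude bound: the leading term 1 - e can use up the whole radius by itself, so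
  closeness to 2/3 cannot be read off here. For alpha and beta it follows from the contraction
  together with the small displacement of the base point.\<close>

lemma fA_near:
  assumes a: "\<bar>a - 2/3\<bar> \<le> radius" "\<bar>e - 1/3\<bar> \<le> radius"
    and i: "\<bar>i - 1/3\<bar> \<le> radius" "\<bar>h - 1/3\<bar> \<le> radius" "\<bar>n - 1/3\<bar> \<le> radius" and s: "0 \<le> s" "s \<le> 1" and k: "\<bar>k\<bar> \<le> radius"
  shows "\<bar>fA k s i h n a e\<bar> \<le> 1"
proof -
  have 1: "\<bar>(1 - n / h) * (a - (1 - e))\<bar> \<le> 1/100 * (2 * radius)"
    by (intro abs_prod_le quot_near i) (use a in linarith)
  have "\<bar>2 * s * (i / h)\<bar> \<le> 2 * (11/10)" using s by (intro abs_prod_le quot_near i) auto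
  then have "\<bar>n / h - 2 * s * (i / h)\<bar> \<le> 4" using quot_near(2)[OF i(3,2)] by linarith
  then have "\<bar>k * ((n / h - 2 * s * (i / h)) * a)\<bar> \<le> radius * (4 * 1)"
    by (intro abs_prod_le k) (use a in linarith)+
  with 1 show ?thesis unfolding fA_def using a by linarith
qed

text \<open>The leading term contributes 36/100 d. In each correction one factor is small (a
  quotient minus 1, a difference such as a - b, or k), so that all of them together fit into the
  remaining 4/100 d and the multiple of \<open>\<epsilon>\<close>.\<close>

lemma fE_diff:
  assumes a1: "\<bar>a1 - 2/3\<bar> \<le> radius" "\<bar>b1 - 2/3\<bar> \<le> radius" "\<bar>e1 - 1/3\<bar> \<le> radius"
    and i1: "\<bar>i1 - 1/3\<bar> \<le> radius" "\<bar>h1 - 1/3\<bar> \<le> radius" "\<bar>n1 - 1/3\<bar> \<le> radius"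
    and a2: "\<bar>a2 - 2/3\<bar> \<le> radius" "\<bar>b2 - 2/3\<bar> \<le> radius" "\<bar>e2 - 1/3\<bar> \<le> radius"
    and i2: "\<bar>i2 - 1/3\<bar> \<le> radius" "\<bar>h2 - 1/3\<bar> \<le> radius" "\<bar>n2 - 1/3\<bar> \<le> radius"
    and s: "0 \<le> s" "s \<le> 1" and k: "\<bar>k1\<bar> \<le> radius" "\<bar>k2\<bar> \<le> radius" "\<bar>k1 - k2\<bar> \<le> \<epsilon>"
    and d: "\<bar>a1 - a2\<bar> \<le> d" "\<bar>b1 - b2\<bar> \<le> d" "\<bar>e1 - e2\<bar> \<le> d"
    and di: "\<bar>i1 - i2\<bar> \<le> 36/100 * d" "\<bar>h1 - h2\<bar> \<le> 36/100 * d" "\<bar>n1 - n2\<bar> \<le> 36/100 * d"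
    and du: "\<bar>(a1 + b1) / 4 - (a2 + b2) / 4\<bar> \<le> 36/100 * d"
  shows "\<bar>fE k1 s i1 h1 n1 a1 b1 e1 - fE k2 s i2 h2 n2 a2 b2 e2\<bar> \<le> 4/10 * d + \<epsilon>"
proof -
  have u1: "\<bar>(a1 + b1) / 4 - 1/3\<bar> \<le> radius" using quarter_near[OF a1(1,2)] by linarith
  have u2: "\<bar>(a2 + b2) / 4 - 1/3\<bar> \<le> radius" using quarter_near[OF a2(1,2)] by linarith
  have pos: "0 \<le> d" "0 \<le> \<epsilon>" using d(1) k(3) by linarith+
  have q: "\<bar>1 - i1 / h1 - (1 - i2 / h2)\<bar> \<le> 3 * d"
    using quot_diff[OF i1(1) i2(1) i1(2) i2(2) di(1,2)] by linarith
  have eu: "\<bar>e2 - (a2 + b2) / 4\<bar> \<le> 2 * radius" using a2(3) u2 by argo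
  have deu: "\<bar>e1 - (a1 + b1) / 4 - (e2 - (a2 + b2) / 4)\<bar> \<le> 136/100 * d" using d(3) du by argo
  have ab: "\<bar>a1 - b1\<bar> \<le> 2 * radius" "\<bar>a2 - b2\<bar> \<le> 2 * radius" using a1(1,2) a2(1,2) by argo+
  have dab: "\<bar>a1 - b1 - (a2 - b2)\<bar> \<le> 2 * d" using d(1,2) by argo
  have 2: "\<bar>(1 - i1 / h1) * (e1 - (a1 + b1) / 4) - (1 - i2 / h2) * (e2 - (a2 + b2) / 4)\<bar>
    \<le> 1/100 * (136/100 * d) + 2 * radius * (3 * d)"
    by (rule prod_diff[OF quot_near(1)[OF i1(1,2)] eu q deu])
  have 3: "\<bar>(a1 - b1) * ((a1 + b1) / 4 / n1) - (a2 - b2) * ((a2 + b2) / 4 / n2)\<bar>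
    \<le> 2 * radius * (3 * d) + 11/10 * (2 * d)"
    by (rule prod_diff[OF ab(1) quot_near(2)[OF u2 i2(3)] dab quot_diff[OF u1 u2 i1(3) i2(3) du di(3)]])
  have 4: "\<bar>(a2 - b2) * ((a2 + b2) / 4 / n2)\<bar> \<le> 2 * radius * (11/10)"
    by (rule abs_prod_le[OF ab(2) quot_near(2)[OF u2 i2(3)]])
  have "\<bar>k1 * ((a1 - b1) * ((a1 + b1) / 4 / n1)) - k2 * ((a2 - b2) * ((a2 + b2) / 4 / n2))\<bar>
    \<le> radius * (2 * radius * (3 * d) + 11/10 * (2 * d)) + 2 * radius * (11/10) * \<epsilon>"
    by (intro prod_diff k 3 4)
  then have "\<bar>(1 - s) / 4 * (k1 * ((a1 - b1) * ((a1 + b1) / 4 / n1)) - k2 * ((a2 - b2) * ((a2 + b2) / 4 / n2)))\<bar>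
    \<le> 1 * (radius * (2 * radius * (3 * d) + 11/10 * (2 * d)) + 2 * radius * (11/10) * \<epsilon>)"
    using s by (intro abs_prod_le) auto
  then have 5: "\<bar>(1 - s) / 4 * (k1 * ((a1 - b1) * ((a1 + b1) / 4 / n1))) - (1 - s) / 4 * (k2 * ((a2 - b2) * ((a2 + b2) / 4 / n2)))\<bar>
    \<le> 1 * (radius * (2 * radius * (3 * d) + 11/10 * (2 * d)) + 2 * radius * (11/10) * \<epsilon>)"
    by (simp only: right_diff_distrib)
  have aux: "\<bar>x1 + y1 + z1 - (x2 + y2 + z2)\<bar> \<le> p + q + r"
    if "\<bar>x1 - x2\<bar> \<le> p" "\<bar>y1 - y2\<bar> \<le> q" "\<bar>z1 - z2\<bar> \<le> r" for x1 x2 y1 y2 z1 z2 p q r :: real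
    using that by argo
  show ?thesis
    unfolding fE_def by (rule order_trans[OF aux[OF du 2 5]]) (use pos in argo)
qed

text \<open>The assumption on e1 - e2 is the bound from \<open>fE_diff\<close> after averaging,
  since e is the updated eta. The leading term 1 - e passes on 4/10 d; the factor 1 - n / h, the
  distance of a from 1 - e and the factor k keep the rest below 1/10 d.\<close>

lemma fA_diff:
  assumes a1: "\<bar>a1 - 2/3\<bar> \<le> radius" "\<bar>e1 - 1/3\<bar> \<le> radius"
    and i1: "\<bar>i1 - 1/3\<bar> \<le> radius" "\<bar>h1 - 1/3\<bar> \<le> radius" "\<bar>n1 - 1/3\<bar> \<le> radius"
    and a2: "\<bar>a2 - 2/3\<bar> \<le> radius" "\<bar>e2 - 1/3\<bar> \<le> radius"
    and i2: "\<bar>i2 - 1/3\<bar> \<le> radius" "\<bar>h2 - 1/3\<bar> \<le> radius" "\<bar>n2 - 1/3\<bar> \<le> radius"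
    and s: "0 \<le> s" "s \<le> 1" and k: "\<bar>k1\<bar> \<le> radius" "\<bar>k2\<bar> \<le> radius" "\<bar>k1 - k2\<bar> \<le> \<epsilon>"
    and d: "\<bar>a1 - a2\<bar> \<le> d" "\<bar>e1 - e2\<bar> \<le> 4/10 * d + \<epsilon>"
    and di: "\<bar>i1 - i2\<bar> \<le> 36/100 * d" "\<bar>h1 - h2\<bar> \<le> 36/100 * d" "\<bar>n1 - n2\<bar> \<le> 36/100 * d"
  shows "\<bar>fA k1 s i1 h1 n1 a1 e1 - fA k2 s i2 h2 n2 a2 e2\<bar> \<le> 5/10 * d + 6 * \<epsilon>"
proof -
  have pos: "0 \<le> d" "0 \<le> \<epsilon>" using d k by linarith+
  note qi = quot_diff[OF i1(1) i2(1) i1(2) i2(2) di(1,2)] and qn = quot_diff[OF i1(3) i2(3) i1(2) i2(2) di(3,2)]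
  have 2: "\<bar>(1 - n1 / h1) * (a1 - (1 - e1)) - (1 - n2 / h2) * (a2 - (1 - e2))\<bar>
    \<le> 1/100 * (14/10 * d + \<epsilon>) + 2 * radius * (3 * d)"
    by (intro prod_diff quot_near i1) (use a2 d qn in linarith)+
  have bd: "\<bar>n / h - 2 * s * (i / h)\<bar> \<le> 4" if "\<bar>i - 1/3\<bar> \<le> radius" "\<bar>h - 1/3\<bar> \<le> radius" "\<bar>n - 1/3\<bar> \<le> radius" for i h n
  proof -
    have "\<bar>2 * s * (i / h)\<bar> \<le> 2 * (11/10)" using s that by (intro abs_prod_le quot_near) auto
    then show ?thesis using quot_near(2)[OF that(3,2)] by linarith
  qed
  have "\<bar>2 * s * (i1 / h1 - i2 / h2)\<bar> \<le> 2 * (3 * d)" using s qi by (intro abs_prod_le) auto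
  then have "\<bar>2 * s * (i1 / h1) - 2 * s * (i2 / h2)\<bar> \<le> 6 * d" by (simp only: right_diff_distrib)
  then have dc: "\<bar>(n1 / h1 - 2 * s * (i1 / h1)) - (n2 / h2 - 2 * s * (i2 / h2))\<bar> \<le> 9 * d" using qn by argo
  have 3: "\<bar>(n1 / h1 - 2 * s * (i1 / h1)) * a1 - (n2 / h2 - 2 * s * (i2 / h2)) * a2\<bar> \<le> 4 * d + 1 * (9 * d)"
    by (intro prod_diff bd i1 d dc) (use a2 in linarith)
  have 4: "\<bar>(n2 / h2 - 2 * s * (i2 / h2)) * a2\<bar> \<le> 4 * 1"
    by (intro abs_prod_le bd i2) (use a2 in linarith)
  have 5: "\<bar>k1 * ((n1 / h1 - 2 * s * (i1 / h1)) * a1) - k2 * ((n2 / h2 - 2 * s * (i2 / h2)) * a2)\<bar>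
    \<le> radius * (4 * d + 1 * (9 * d)) + 4 * 1 * \<epsilon>"
    by (intro prod_diff k 3 4)
  have aux: "\<bar>x1 + y1 - z1 - (x2 + y2 - z2)\<bar> \<le> p + q + r"
    if "\<bar>x1 - x2\<bar> \<le> p" "\<bar>y1 - y2\<bar> \<le> q" "\<bar>z1 - z2\<bar> \<le> r" for x1 x2 y1 y2 z1 z2 p q r :: real
    using that by linarith
  have "\<bar>(1 - e1) - (1 - e2)\<bar> \<le> 4/10 * d + \<epsilon>" using d by linarith
  from aux[OF this 2 5] show ?thesis
    unfolding fA_def by (rule order_trans) (use pos in argo)
qed

section \<open>Solution operators: closeness, differences, and dependence on the rate\<close>

lemma bounded_sol_near:
  assumes C: "\<And>y. (C has_real_derivative c y) (at y)" "filterlim C at_top at_top" "\<And>y. 0 \<le> c y"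
    and c: "continuous_on UNIV c"
    and f: "continuous_on UNIV f" "\<And>y. \<bar>f y - m\<bar> \<le> K"
  shows "(bounded_sol c f has_real_derivative c y * (bounded_sol c f y - f y)) (at y)" "\<bar>bounded_sol c f y - m\<bar> \<le> K"
proof -
  have fK: "\<bar>f y\<bar> \<le> \<bar>m\<bar> + K" for y using f(2)[of y] by linarith
  note z = bounded_sol[OF C c f(1) fK]
  show "(bounded_sol c f has_real_derivative c y * (bounded_sol c f y - f y)) (at y)" by (rule z)
  obtain B where B: "\<And>y. \<bar>bounded_sol c f y\<bar> \<le> B" using z(2) unfolding bounded_iff by auto
  have b: "bounded (range (\<lambda>y. bounded_sol c f y - m))"
    unfolding bounded_iff
  proof (intro exI ballI)
    fix x assume "x \<in> range (\<lambda>y. bounded_sol c f y - m)"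
    then obtain y where "x = bounded_sol c f y - m" by auto
    then show "norm x \<le> B + \<bar>m\<bar>" using B[of y] by simp
  qed
  have d: "((\<lambda>y. bounded_sol c f y - m) has_real_derivative c y * (bounded_sol c f y - m - (f y - m))) (at y)" for y
    using DERIV_diff[OF z(1)[of y] DERIV_const[of m]] by simp
  show "\<bar>bounded_sol c f y - m\<bar> \<le> K" by (rule bounded_sol_bound[OF d b C f(2)])
qed

lemma bounded_sol_diff:
  assumes z1: "\<And>y. (z1 has_real_derivative c y * (z1 y - f1 y)) (at y)" "\<And>y. \<bar>z1 y\<bar> \<le> B"
    and z2: "\<And>y. (z2 has_real_derivative c y * (z2 y - f2 y)) (at y)" "\<And>y. \<bar>z2 y\<bar> \<le> B"
    and C: "\<And>y. (C has_real_derivative c y) (at y)" "filterlim C at_top at_top" "\<And>y. 0 \<le> c y"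
    and f: "\<And>y. \<bar>f1 y - f2 y\<bar> \<le> K"
  shows "\<bar>z1 y - z2 y\<bar> \<le> K"
proof (rule bounded_sol_bound[where z = "\<lambda>y. z1 y - z2 y", OF _ _ C f])
  show "((\<lambda>y. z1 y - z2 y) has_real_derivative c y * (z1 y - z2 y - (f1 y - f2 y))) (at y)" for y
    using DERIV_diff[OF z1(1)[of y] z2(1)[of y]] by (simp add: algebra_simps)
  show "bounded (range (\<lambda>y. z1 y - z2 y))"
    unfolding bounded_iff
  proof (intro exI ballI)
    fix x assume "x \<in> range (\<lambda>y. z1 y - z2 y)"
    then obtain y where "x = z1 y - z2 y" by auto
    then show "norm x \<le> 2 * B" using z1(2)[of y] z2(2)[of y] by simp
  qed
qed

text \<open>The second equation is rewritten with rate k1 by moving the discrepancy into its source: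
  f2 becomes z2 - k2 / k1 (z2 - f2), which differs from f2 by (k1 - k2) / k1 (z2 - f2). Both
  solutions then belong to the same averaging operator. This is what makes the fixed point depend
  continuously on kappa.\<close>

lemma bounded_sol_const_diff:
  assumes k: "1 \<le> k1" "1 \<le> (k2::real)"
    and z1: "\<And>y. (z1 has_real_derivative k1 * (z1 y - f1 y)) (at y)" "\<And>y. \<bar>z1 y\<bar> \<le> 1"
    and z2: "\<And>y. (z2 has_real_derivative k2 * (z2 y - f2 y)) (at y)" "\<And>y. \<bar>z2 y\<bar> \<le> 1"
    and f: "\<And>y. \<bar>f1 y - f2 y\<bar> \<le> K" "\<And>y. \<bar>f2 y\<bar> \<le> 1"
  shows "\<bar>z1 y - z2 y\<bar> \<le> K + 2 * \<bar>k1 - k2\<bar>"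
proof (rule bounded_sol_diff[of z1 "\<lambda>_. k1" f1 1 z2 "\<lambda>y. z2 y - k2 / k1 * (z2 y - f2 y)" "\<lambda>y. k1 * y"])
  show "(z2 has_real_derivative k1 * (z2 y - (z2 y - k2 / k1 * (z2 y - f2 y)))) (at y)" for y
    using z2(1)[of y] k by simp
  show "((*) k1 has_real_derivative k1) (at y)" for y
    using DERIV_cmult_Id[of k1] by simp
  show "filterlim ((*) k1) at_top at_top"
    using k by (intro filterlim_tendsto_pos_mult_at_top[OF tendsto_const] filterlim_ident) auto
  show "\<bar>f1 y - (z2 y - k2 / k1 * (z2 y - f2 y))\<bar> \<le> K + 2 * \<bar>k1 - k2\<bar>" for y
  proof -
    have "\<bar>(k1 - k2) / k1 * (z2 y - f2 y)\<bar> \<le> \<bar>k1 - k2\<bar> * 2"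
    proof (rule abs_prod_le)
      show "\<bar>(k1 - k2) / k1\<bar> \<le> \<bar>k1 - k2\<bar>"
        using k mult_left_mono[of 1 k1 "\<bar>k1 - k2\<bar>"] by (simp add: abs_divide pos_divide_le_eq)
      show "\<bar>z2 y - f2 y\<bar> \<le> 2" using z2(2)[of y] f(2)[of y] by linarith
    qed
    moreover have "f1 y - (z2 y - k2 / k1 * (z2 y - f2 y)) = (f1 y - f2 y) - (k1 - k2) / k1 * (z2 y - f2 y)"
      using k by (simp add: field_simps)
    ultimately show ?thesis using f(1)[of y] by argo
  qed
qed (use z1 z2 k in auto)

text \<open>A primitive of the rate 4 s of the eta equation. It grows at +infinity although the rate
  vanishes at s = 0, which is all that the averaging needs.\<close>

definition potE :: "real \<Rightarrow> real" where "potE y = 4 * ln (1 + exp y)"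

lemma DERIV_potE: "(potE has_real_derivative 4 * lg y) (at y)"
proof -
  have p: "1 + exp y > 0" by (simp add: add_pos_pos)
  then have "(potE has_real_derivative 4 * (exp y / (1 + exp y))) (at y)"
    unfolding potE_def[abs_def] by (auto intro!: derivative_eq_intros simp: divide_simps)
  moreover have "exp y / (1 + exp y) = lg y"
  proof -
    have "1 + exp (- y) > 0" by (simp add: add_pos_pos)
    moreover have "exp y * exp (- y) = 1" by (simp flip: exp_add)
    ultimately show ?thesis using p by (simp add: lg_def field_simps)
  qed
  ultimately show ?thesis by simp
qed

lemma potE_at_top: "filterlim potE at_top at_top"
proof -
  have "4 * y \<le> potE y" for y
  proof -
    have "ln (exp y) \<le> ln (1 + exp y)" by (subst ln_le_cancel_iff) (auto simp: add_pos_pos)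
    then show ?thesis by (simp add: potE_def)
  qed
  moreover have "filterlim (\<lambda>y::real. 4 * y) at_top at_top"
    by (intro filterlim_tendsto_pos_mult_at_top[OF tendsto_const] filterlim_ident) auto
  ultimately show ?thesis by (intro filterlim_at_top_mono[of _ at_top potE]) (auto intro: always_eventually)
qed

lemma const_rate:
  assumes "(k::real) > 0"
  shows "((*) k has_real_derivative k) (at y)" "filterlim ((*) k) at_top at_top" "0 \<le> k"
    "continuous_on UNIV (\<lambda>_::real. k)"
  using assms DERIV_cmult_Id[of k]
  by (auto intro!: filterlim_tendsto_pos_mult_at_top[OF tendsto_const] filterlim_ident)

lemma rate_E:
  "\<And>y. (potE has_real_derivative 4 * lg y) (at y)" "filterlim potE at_top at_top" "\<And>y. 0 \<le> 4 * lg y"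
  "continuous_on UNIV (\<lambda>y. 4 * lg y)"
  by (auto intro: DERIV_potE potE_at_top continuous_intros)

section \<open>The fixed point map\<close>

definition ups :: "(real \<Rightarrow> real) \<Rightarrow> (real \<Rightarrow> real) \<Rightarrow> real \<Rightarrow> real" where
  "ups \<alpha> \<beta> y = (\<alpha> y + \<beta> y) / 4"

definition srcE :: "real \<Rightarrow> (real \<Rightarrow> real) \<Rightarrow> (real \<Rightarrow> real) \<Rightarrow> (real \<Rightarrow> real) \<Rightarrow> real \<Rightarrow> real" where
  "srcE \<kappa> \<alpha> \<beta> \<eta> y = fE (1 / \<kappa>) (lg y) (avgI (ups \<alpha> \<beta>) y) (avgH (ups \<alpha> \<beta>) y) (avgN (ups \<alpha> \<beta>)) (\<alpha> y) (\<beta> y) (\<eta> y)"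

definition srcA :: "real \<Rightarrow> (real \<Rightarrow> real) \<Rightarrow> (real \<Rightarrow> real) \<Rightarrow> (real \<Rightarrow> real) \<Rightarrow> real \<Rightarrow> real" where
  "srcA k u \<alpha> \<eta> y = fA k (lg y) (avgI u y) (avgH u y) (avgN u) (\<alpha> y) (\<eta> y)"

text \<open>The maps for alpha and beta use the updated eta: this makes them follow 1 - eta, whose Lipschitz constant is about 1/2.\<close>
definition newE :: "real \<Rightarrow> (real \<Rightarrow> real) \<Rightarrow> (real \<Rightarrow> real) \<Rightarrow> (real \<Rightarrow> real) \<Rightarrow> real \<Rightarrow> real" where
  "newE \<kappa> \<alpha> \<beta> \<eta> = bounded_sol (\<lambda>y. 4 * lg y) (srcE \<kappa> \<alpha> \<beta> \<eta>)"

text \<open>The rate of alpha is -kappa, so its bounded solution averages over the past; reflecting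
  y before and after reduces it to the operator that averages over the future.\<close>

definition newA :: "real \<Rightarrow> (real \<Rightarrow> real) \<Rightarrow> (real \<Rightarrow> real) \<Rightarrow> (real \<Rightarrow> real) \<Rightarrow> real \<Rightarrow> real" where
  "newA \<kappa> \<alpha> \<beta> \<eta> y = bounded_sol (\<lambda>_. \<kappa>) (\<lambda>x. srcA (1 / \<kappa>) (ups \<alpha> \<beta>) \<alpha> (newE \<kappa> \<alpha> \<beta> \<eta>) (- x)) (- y)"

definition newB :: "real \<Rightarrow> (real \<Rightarrow> real) \<Rightarrow> (real \<Rightarrow> real) \<Rightarrow> (real \<Rightarrow> real) \<Rightarrow> real \<Rightarrow> real" where
  "newB \<kappa> \<alpha> \<beta> \<eta> = bounded_sol (\<lambda>_. \<kappa>) (srcA (- (1 / \<kappa>)) (ups \<alpha> \<beta>) \<beta> (newE \<kappa> \<alpha> \<beta> \<eta>))"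

definition near :: "(real \<Rightarrow> real) \<Rightarrow> (real \<Rightarrow> real) \<Rightarrow> (real \<Rightarrow> real) \<Rightarrow> bool" where
  "near \<alpha> \<beta> \<eta> \<longleftrightarrow> continuous_on UNIV \<alpha> \<and> continuous_on UNIV \<beta> \<and> continuous_on UNIV \<eta> \<and>
     (\<forall>y. \<bar>\<alpha> y - 2/3\<bar> \<le> radius \<and> \<bar>\<beta> y - 2/3\<bar> \<le> radius \<and> \<bar>\<eta> y - 1/3\<bar> \<le> radius)"

text \<open>One application of the map moves the base point by at most 9/5 / kappa. This has to fit
  into a tenth of the radius, which is what the contraction factor 9/10 leaves; 1 / kappa also has
  to be at most the radius.\<close>

abbreviation kappa0 :: real where "kappa0 \<equiv> 100000"

lemma nearD:
  assumes "near \<alpha> \<beta> \<eta>"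
  shows "continuous_on UNIV \<alpha>" "continuous_on UNIV \<beta>" "continuous_on UNIV \<eta>"
    "\<bar>\<alpha> y - 2/3\<bar> \<le> radius" "\<bar>\<beta> y - 2/3\<bar> \<le> radius" "\<bar>\<eta> y - 1/3\<bar> \<le> radius"
  using assms unfolding near_def by blast+

lemma near_ups:
  assumes "near \<alpha> \<beta> \<eta>"
  shows "\<bar>ups \<alpha> \<beta> y - 1/3\<bar> \<le> radius" "bounded_cont (ups \<alpha> \<beta>)"
    "\<bar>avgI (ups \<alpha> \<beta>) y - 1/3\<bar> \<le> radius" "\<bar>avgH (ups \<alpha> \<beta>) y - 1/3\<bar> \<le> radius" "\<bar>avgN (ups \<alpha> \<beta>) - 1/3\<bar> \<le> radius"
proof -
  have u: "\<bar>ups \<alpha> \<beta> y - 1/3\<bar> \<le> radius" for y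
    using quarter_near[OF nearD(4)[OF assms, of y] nearD(5)[OF assms, of y]] unfolding ups_def by linarith
  then show "\<bar>ups \<alpha> \<beta> y - 1/3\<bar> \<le> radius" .
  have "continuous_on UNIV (ups \<alpha> \<beta>)" unfolding ups_def[abs_def]
    by (intro continuous_intros nearD[OF assms]) auto
  moreover have "\<bar>ups \<alpha> \<beta> y\<bar> \<le> 1" for y using u[of y] by linarith
  ultimately show b: "bounded_cont (ups \<alpha> \<beta>)" unfolding bounded_cont_def by blast
  have c: "bounded_cont (\<lambda>_. 1/3)" by (auto simp: bounded_cont_def intro: exI[of _ 1])
  show "\<bar>avgI (ups \<alpha> \<beta>) y - 1/3\<bar> \<le> radius" "\<bar>avgH (ups \<alpha> \<beta>) y - 1/3\<bar> \<le> radius" "\<bar>avgN (ups \<alpha> \<beta>) - 1/3\<bar> \<le> radius"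
    using avgI_diff[OF b c u] avgH_diff[OF b c u] avgN_diff[OF b c u]
    by (simp_all add: avgI_const avgH_const avgN_const)
qed

lemma avgH_pos: "near \<alpha> \<beta> \<eta> \<Longrightarrow> 33/100 < avgH (ups \<alpha> \<beta>) y" "near \<alpha> \<beta> \<eta> \<Longrightarrow> 33/100 < avgN (ups \<alpha> \<beta>)"
  using near_ups(4)[of \<alpha> \<beta> \<eta> y] near_ups(5)[of \<alpha> \<beta> \<eta>] by linarith+

lemma avgH_nz: "near \<alpha> \<beta> \<eta> \<Longrightarrow> avgH (ups \<alpha> \<beta>) y \<noteq> 0" "near \<alpha> \<beta> \<eta> \<Longrightarrow> avgN (ups \<alpha> \<beta>) \<noteq> 0"
  using avgH_pos(1)[of \<alpha> \<beta> \<eta> y] avgH_pos(2)[of \<alpha> \<beta> \<eta>] by auto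

lemma kinv: assumes "kappa0 \<le> \<kappa>" shows "\<bar>1 / \<kappa>\<bar> \<le> radius" "\<bar>- (1 / \<kappa>)\<bar> \<le> radius" "1 / \<kappa> \<le> 1 / kappa0"
proof -
  show "1 / \<kappa> \<le> 1 / kappa0" using assms by (intro divide_left_mono) auto
  moreover have "0 \<le> 1 / \<kappa>" using assms by simp
  ultimately show "\<bar>1 / \<kappa>\<bar> \<le> radius" "\<bar>- (1 / \<kappa>)\<bar> \<le> radius" by linarith+
qed

lemma newE:
  assumes n: "near \<alpha> \<beta> \<eta>" and k: "kappa0 \<le> \<kappa>"
  shows "(newE \<kappa> \<alpha> \<beta> \<eta> has_real_derivative 4 * lg y * (newE \<kappa> \<alpha> \<beta> \<eta> y - srcE \<kappa> \<alpha> \<beta> \<eta> y)) (at y)"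
    "\<bar>newE \<kappa> \<alpha> \<beta> \<eta> y - 1/3\<bar> \<le> radius" "continuous_on UNIV (newE \<kappa> \<alpha> \<beta> \<eta>)"
proof -
  have c: "continuous_on UNIV (srcE \<kappa> \<alpha> \<beta> \<eta>)"
    unfolding srcE_def[abs_def] fE_def
    by (intro continuous_intros nearD[OF n] continuous_avgI continuous_avgH near_ups[OF n] ballI avgH_nz[OF n]) simp_all
  have s: "\<bar>srcE \<kappa> \<alpha> \<beta> \<eta> y - 1/3\<bar> \<le> radius" for y
    unfolding srcE_def by (intro fE_near nearD[OF n] near_ups[OF n] lg_bounds kinv k)
  note * = bounded_sol_near[OF rate_E c s]
  show d: "(newE \<kappa> \<alpha> \<beta> \<eta> has_real_derivative 4 * lg y * (newE \<kappa> \<alpha> \<beta> \<eta> y - srcE \<kappa> \<alpha> \<beta> \<eta> y)) (at y)" for y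
    unfolding newE_def by (rule *)
  show "\<bar>newE \<kappa> \<alpha> \<beta> \<eta> y - 1/3\<bar> \<le> radius" unfolding newE_def by (rule *)
  show "continuous_on UNIV (newE \<kappa> \<alpha> \<beta> \<eta>)" by (rule DERIV_continuous_on[OF has_field_derivative_at_within[OF d]])
qed

lemma srcA:
  assumes n: "near \<alpha> \<beta> \<eta>" and e: "\<And>y. \<bar>\<epsilon> y - 1/3\<bar> \<le> radius" "continuous_on UNIV \<epsilon>"
    and a: "\<And>y. \<bar>a y - 2/3\<bar> \<le> radius" "continuous_on UNIV a" and k: "\<bar>k\<bar> \<le> radius"
  shows "continuous_on UNIV (srcA k (ups \<alpha> \<beta>) a \<epsilon>)" "\<bar>srcA k (ups \<alpha> \<beta>) a \<epsilon> y\<bar> \<le> 1"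
proof -
  show "continuous_on UNIV (srcA k (ups \<alpha> \<beta>) a \<epsilon>)"
    unfolding srcA_def[abs_def] fA_def
    by (intro continuous_intros e a continuous_avgI continuous_avgH near_ups[OF n] ballI avgH_nz[OF n])
  show "\<bar>srcA k (ups \<alpha> \<beta>) a \<epsilon> y\<bar> \<le> 1"
    unfolding srcA_def by (intro fA_near e a near_ups[OF n] lg_bounds k)
qed

lemma newB:
  assumes n: "near \<alpha> \<beta> \<eta>" and k: "kappa0 \<le> \<kappa>"
  shows "(newB \<kappa> \<alpha> \<beta> \<eta> has_real_derivative
      \<kappa> * (newB \<kappa> \<alpha> \<beta> \<eta> y - srcA (- (1 / \<kappa>)) (ups \<alpha> \<beta>) \<beta> (newE \<kappa> \<alpha> \<beta> \<eta>) y)) (at y)"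
    "\<bar>newB \<kappa> \<alpha> \<beta> \<eta> y\<bar> \<le> 1"
proof -
  have k0: "\<kappa> > 0" using k by simp
  note s = srcA[OF n newE(2,3)[OF n k] nearD(5,2)[OF n] kinv(2)[OF k]]
  have s0: "\<bar>srcA (- (1 / \<kappa>)) (ups \<alpha> \<beta>) \<beta> (newE \<kappa> \<alpha> \<beta> \<eta>) y - 0\<bar> \<le> 1" for y using s(2) by simp
  note * = bounded_sol_near[OF const_rate[OF k0] s(1) s0]
  show "(newB \<kappa> \<alpha> \<beta> \<eta> has_real_derivative
      \<kappa> * (newB \<kappa> \<alpha> \<beta> \<eta> y - srcA (- (1 / \<kappa>)) (ups \<alpha> \<beta>) \<beta> (newE \<kappa> \<alpha> \<beta> \<eta>) y)) (at y)"
    unfolding newB_def by (rule *)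
  show "\<bar>newB \<kappa> \<alpha> \<beta> \<eta> y\<bar> \<le> 1" using *(2)[of y] by (simp add: newB_def)
qed

lemma newA:
  assumes n: "near \<alpha> \<beta> \<eta>" and k: "kappa0 \<le> \<kappa>"
  shows "((\<lambda>y. newA \<kappa> \<alpha> \<beta> \<eta> (- y)) has_real_derivative
      \<kappa> * (newA \<kappa> \<alpha> \<beta> \<eta> (- y) - srcA (1 / \<kappa>) (ups \<alpha> \<beta>) \<alpha> (newE \<kappa> \<alpha> \<beta> \<eta>) (- y))) (at y)"
    "(newA \<kappa> \<alpha> \<beta> \<eta> has_real_derivative
      - \<kappa> * (newA \<kappa> \<alpha> \<beta> \<eta> y - srcA (1 / \<kappa>) (ups \<alpha> \<beta>) \<alpha> (newE \<kappa> \<alpha> \<beta> \<eta>) y)) (at y)"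
    "\<bar>newA \<kappa> \<alpha> \<beta> \<eta> y\<bar> \<le> 1"
proof -
  have k0: "\<kappa> > 0" using k by simp
  let ?s = "srcA (1 / \<kappa>) (ups \<alpha> \<beta>) \<alpha> (newE \<kappa> \<alpha> \<beta> \<eta>)"
  note s = srcA[OF n newE(2,3)[OF n k] nearD(4,1)[OF n] kinv(1)[OF k]]
  have s0: "\<bar>?s (- y) - 0\<bar> \<le> 1" for y using s(2) by simp
  have c: "continuous_on UNIV (\<lambda>y. ?s (- y))"
    by (intro continuous_on_compose2[OF s(1)] continuous_intros) auto
  note * = bounded_sol_near[OF const_rate[OF k0] c s0]
  show d: "((\<lambda>y. newA \<kappa> \<alpha> \<beta> \<eta> (- y)) has_real_derivative \<kappa> * (newA \<kappa> \<alpha> \<beta> \<eta> (- y) - ?s (- y))) (at y)" for y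
    unfolding newA_def minus_minus by (rule *)
  show "(newA \<kappa> \<alpha> \<beta> \<eta> has_real_derivative - \<kappa> * (newA \<kappa> \<alpha> \<beta> \<eta> y - ?s y)) (at y)"
    using DERIV_reflect[OF d, of y] by simp
  show "\<bar>newA \<kappa> \<alpha> \<beta> \<eta> y\<bar> \<le> 1" using *(2)[of "- y"] by (simp add: newA_def)
qed

text \<open>The fourth bound in \<open>d\<close> is assumed separately because the first two alone
  give only d / 2 for \<open>ups\<close>; the Euclidean norm on triples improves it to 36/100 d. Two
  values of kappa are compared at once, so that contraction and continuity in kappa come out of one
  estimate.\<close>

lemma step_diff:
  assumes n1: "near \<alpha>1 \<beta>1 \<eta>1" and k1: "kappa0 \<le> \<kappa>1" and n2: "near \<alpha>2 \<beta>2 \<eta>2" and k2: "kappa0 \<le> \<kappa>2"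
    and d: "\<And>y. \<bar>\<alpha>1 y - \<alpha>2 y\<bar> \<le> d" "\<And>y. \<bar>\<beta>1 y - \<beta>2 y\<bar> \<le> d" "\<And>y. \<bar>\<eta>1 y - \<eta>2 y\<bar> \<le> d"
      "\<And>y. \<bar>ups \<alpha>1 \<beta>1 y - ups \<alpha>2 \<beta>2 y\<bar> \<le> 36/100 * d"
  shows "\<bar>newE \<kappa>1 \<alpha>1 \<beta>1 \<eta>1 y - newE \<kappa>2 \<alpha>2 \<beta>2 \<eta>2 y\<bar> \<le> 5/10 * d + 8 * \<bar>\<kappa>1 - \<kappa>2\<bar>"
    "\<bar>newA \<kappa>1 \<alpha>1 \<beta>1 \<eta>1 y - newA \<kappa>2 \<alpha>2 \<beta>2 \<eta>2 y\<bar> \<le> 5/10 * d + 8 * \<bar>\<kappa>1 - \<kappa>2\<bar>"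
    "\<bar>newB \<kappa>1 \<alpha>1 \<beta>1 \<eta>1 y - newB \<kappa>2 \<alpha>2 \<beta>2 \<eta>2 y\<bar> \<le> 5/10 * d + 8 * \<bar>\<kappa>1 - \<kappa>2\<bar>"
proof -
  have ki: "\<bar>1 / \<kappa>1 - 1 / \<kappa>2\<bar> \<le> \<bar>\<kappa>1 - \<kappa>2\<bar>"
  proof -
    have "1 * 1 \<le> \<kappa>1 * \<kappa>2" using k1 k2 by (intro mult_mono) auto
    moreover have "1 / \<kappa>1 - 1 / \<kappa>2 = (\<kappa>2 - \<kappa>1) / (\<kappa>1 * \<kappa>2)" using k1 k2 by (simp add: field_simps)
    ultimately show ?thesis
      using mult_left_mono[of 1 "\<kappa>1 * \<kappa>2" "\<bar>\<kappa>1 - \<kappa>2\<bar>"]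
      by (simp add: abs_divide abs_minus_commute pos_divide_le_eq)
  qed
  have ki': "\<bar>- (1 / \<kappa>1) - - (1 / \<kappa>2)\<bar> \<le> \<bar>\<kappa>1 - \<kappa>2\<bar>" using ki by linarith
  have d0: "0 \<le> d" using d(1)[of 0] by linarith
  note bI = avgI_diff[OF near_ups(2)[OF n1] near_ups(2)[OF n2] d(4)]
    and bH = avgH_diff[OF near_ups(2)[OF n1] near_ups(2)[OF n2] d(4)]
    and bN = avgN_diff[OF near_ups(2)[OF n1] near_ups(2)[OF n2] d(4)]
  have sE: "\<bar>srcE \<kappa>1 \<alpha>1 \<beta>1 \<eta>1 y - srcE \<kappa>2 \<alpha>2 \<beta>2 \<eta>2 y\<bar> \<le> 4/10 * d + \<bar>\<kappa>1 - \<kappa>2\<bar>" for y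
    unfolding srcE_def
    by (intro fE_diff nearD[OF n1] nearD[OF n2] near_ups[OF n1] near_ups[OF n2] lg_bounds kinv k1 k2 ki d(1-3) bI bH bN
          d(4)[unfolded ups_def])
  have E1: "\<bar>newE \<kappa>1 \<alpha>1 \<beta>1 \<eta>1 y\<bar> \<le> 1" and E2: "\<bar>newE \<kappa>2 \<alpha>2 \<beta>2 \<eta>2 y\<bar> \<le> 1" for y
    using newE(2)[OF n1 k1, of y] newE(2)[OF n2 k2, of y] by linarith+
  have E: "\<bar>newE \<kappa>1 \<alpha>1 \<beta>1 \<eta>1 y - newE \<kappa>2 \<alpha>2 \<beta>2 \<eta>2 y\<bar> \<le> 4/10 * d + \<bar>\<kappa>1 - \<kappa>2\<bar>" for y
    by (rule bounded_sol_diff[OF newE(1)[OF n1 k1] E1 newE(1)[OF n2 k2] E2 rate_E(1-3) sE])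
  show "\<bar>newE \<kappa>1 \<alpha>1 \<beta>1 \<eta>1 y - newE \<kappa>2 \<alpha>2 \<beta>2 \<eta>2 y\<bar> \<le> 5/10 * d + 8 * \<bar>\<kappa>1 - \<kappa>2\<bar>"
    using E[of y] d0 abs_ge_zero[of "\<kappa>1 - \<kappa>2"] by argo
  have one: "1 \<le> \<kappa>1" "1 \<le> \<kappa>2" using k1 k2 by auto
  have sB: "\<bar>srcA (- (1 / \<kappa>1)) (ups \<alpha>1 \<beta>1) \<beta>1 (newE \<kappa>1 \<alpha>1 \<beta>1 \<eta>1) y
      - srcA (- (1 / \<kappa>2)) (ups \<alpha>2 \<beta>2) \<beta>2 (newE \<kappa>2 \<alpha>2 \<beta>2 \<eta>2) y\<bar> \<le> 5/10 * d + 6 * \<bar>\<kappa>1 - \<kappa>2\<bar>" for y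
    unfolding srcA_def
    by (intro fA_diff nearD[OF n1] nearD[OF n2] newE(2) n1 n2 near_ups[OF n1] near_ups[OF n2] lg_bounds kinv k1 k2 ki' d(2) E bI bH bN)
  have sA: "\<bar>srcA (1 / \<kappa>1) (ups \<alpha>1 \<beta>1) \<alpha>1 (newE \<kappa>1 \<alpha>1 \<beta>1 \<eta>1) y
      - srcA (1 / \<kappa>2) (ups \<alpha>2 \<beta>2) \<alpha>2 (newE \<kappa>2 \<alpha>2 \<beta>2 \<eta>2) y\<bar> \<le> 5/10 * d + 6 * \<bar>\<kappa>1 - \<kappa>2\<bar>" for y
    unfolding srcA_def
    by (intro fA_diff nearD[OF n1] nearD[OF n2] newE(2) n1 n2 near_ups[OF n1] near_ups[OF n2] lg_bounds kinv k1 k2 ki d(1) E bI bH bN)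
  have "\<bar>newB \<kappa>1 \<alpha>1 \<beta>1 \<eta>1 y - newB \<kappa>2 \<alpha>2 \<beta>2 \<eta>2 y\<bar> \<le> 5/10 * d + 6 * \<bar>\<kappa>1 - \<kappa>2\<bar> + 2 * \<bar>\<kappa>1 - \<kappa>2\<bar>"
    by (rule bounded_sol_const_diff[OF one newB[OF n1 k1] newB[OF n2 k2] sB
        srcA(2)[OF n2 newE(2,3)[OF n2 k2] nearD(5,2)[OF n2] kinv(2)[OF k2]]])
  then show "\<bar>newB \<kappa>1 \<alpha>1 \<beta>1 \<eta>1 y - newB \<kappa>2 \<alpha>2 \<beta>2 \<eta>2 y\<bar> \<le> 5/10 * d + 8 * \<bar>\<kappa>1 - \<kappa>2\<bar>" by argo
  have "\<bar>newA \<kappa>1 \<alpha>1 \<beta>1 \<eta>1 (- (- y)) - newA \<kappa>2 \<alpha>2 \<beta>2 \<eta>2 (- (- y))\<bar> \<le> 5/10 * d + 6 * \<bar>\<kappa>1 - \<kappa>2\<bar> + 2 * \<bar>\<kappa>1 - \<kappa>2\<bar>"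
    by (rule bounded_sol_const_diff[OF one newA(1)[OF n1 k1] newA(3)[OF n1 k1] newA(1)[OF n2 k2] newA(3)[OF n2 k2] sA
        srcA(2)[OF n2 newE(2,3)[OF n2 k2] nearD(4,1)[OF n2] kinv(1)[OF k2]]])
  then show "\<bar>newA \<kappa>1 \<alpha>1 \<beta>1 \<eta>1 y - newA \<kappa>2 \<alpha>2 \<beta>2 \<eta>2 y\<bar> \<le> 5/10 * d + 8 * \<bar>\<kappa>1 - \<kappa>2\<bar>"
    unfolding minus_minus by argo
qed

section \<open>Bounded continuous triples and the fixed point\<close>

type_synonym state = "real \<Rightarrow>\<^sub>C (real \<times> real \<times> real)"

definition comp_alpha :: "state \<Rightarrow> real \<Rightarrow> real" where "comp_alpha X y = fst (apply_bcontfun X y)"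
definition comp_beta :: "state \<Rightarrow> real \<Rightarrow> real" where "comp_beta X y = fst (snd (apply_bcontfun X y))"
definition comp_eta :: "state \<Rightarrow> real \<Rightarrow> real" where "comp_eta X y = snd (snd (apply_bcontfun X y))"

definition step :: "real \<Rightarrow> state \<Rightarrow> state" where
  "step \<kappa> X = Bcontfun (\<lambda>y. (newA \<kappa> (comp_alpha X) (comp_beta X) (comp_eta X) y, newB \<kappa> (comp_alpha X) (comp_beta X) (comp_eta X) y, newE \<kappa> (comp_alpha X) (comp_beta X) (comp_eta X) y))"

definition X0 :: state where "X0 = const_bcontfun (2/3, 2/3, 1/3)"

lemma X0_comps [simp]: "comp_alpha X0 y = 2/3" "comp_beta X0 y = 2/3" "comp_eta X0 y = 1/3"
  by (simp_all add: comp_alpha_def comp_beta_def comp_eta_def X0_def const_bcontfun.rep_eq)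

text \<open>The metric on triples is Euclidean, hence the constants: sqrt 2 / 4 < 36/100 for the
  mean (a + b) / 4, and sqrt 3 < 9/5 for passing from componentwise bounds to the distance.\<close>

lemma dist_triple:
  fixes p q :: "real \<times> real \<times> real"
  shows "\<bar>fst p - fst q\<bar> \<le> dist p q" "\<bar>fst (snd p) - fst (snd q)\<bar> \<le> dist p q" "\<bar>snd (snd p) - snd (snd q)\<bar> \<le> dist p q"
    "\<bar>(fst p + fst (snd p)) / 4 - (fst q + fst (snd q)) / 4\<bar> \<le> 36/100 * dist p q"
    "\<lbrakk>\<bar>fst p - fst q\<bar> \<le> b; \<bar>fst (snd p) - fst (snd q)\<bar> \<le> b; \<bar>snd (snd p) - snd (snd q)\<bar> \<le> b\<rbrakk> \<Longrightarrow> dist p q \<le> 9/5 * b"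
proof -
  obtain a1 b1 e1 where p: "p = (a1, b1, e1)" by (cases p)
  obtain a2 b2 e2 where q: "q = (a2, b2, e2)" by (cases q)
  have D: "(dist p q)\<^sup>2 = (a1 - a2)\<^sup>2 + (b1 - b2)\<^sup>2 + (e1 - e2)\<^sup>2"
    by (simp add: p q dist_prod_def dist_real_def)
  have le: "\<bar>x\<bar> \<le> c * dist p q" if "x\<^sup>2 \<le> c\<^sup>2 * (dist p q)\<^sup>2" "0 \<le> c" for x c :: real
    using that by (metis abs_le_square_iff abs_of_nonneg mult_nonneg_nonneg power_mult_distrib zero_le_dist)
  show "\<bar>fst p - fst q\<bar> \<le> dist p q" "\<bar>fst (snd p) - fst (snd q)\<bar> \<le> dist p q" "\<bar>snd (snd p) - snd (snd q)\<bar> \<le> dist p q"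
    using le[of _ 1] D by (simp_all add: p q)
  have "((a1 + b1) / 4 - (a2 + b2) / 4)\<^sup>2 \<le> (36/100)\<^sup>2 * (dist p q)\<^sup>2"
  proof -
    have "((a1 + b1) / 4 - (a2 + b2) / 4)\<^sup>2 = ((a1 - a2) + (b1 - b2))\<^sup>2 / 16"
      by (simp add: power2_eq_square field_simps)
    also have "((a1 - a2) + (b1 - b2))\<^sup>2 \<le> 2 * ((a1 - a2)\<^sup>2 + (b1 - b2)\<^sup>2)"
      using zero_le_power2[of "(a1 - a2) - (b1 - b2)"] by (simp add: power2_eq_square algebra_simps)
    also have "\<dots> \<le> 2 * (dist p q)\<^sup>2" unfolding D by simp
    finally have "((a1 + b1) / 4 - (a2 + b2) / 4)\<^sup>2 \<le> 2 * (dist p q)\<^sup>2 / 16" by simp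
    moreover have "A \<le> (36/100)\<^sup>2 * D" if "A \<le> 2 * D / 16" "0 \<le> D" for A D :: real
      using that by (simp add: power2_eq_square)
    ultimately show ?thesis using zero_le_power2 by blast
  qed
  from le[OF this] show "\<bar>(fst p + fst (snd p)) / 4 - (fst q + fst (snd q)) / 4\<bar> \<le> 36/100 * dist p q"
    by (simp add: p q)
  assume b: "\<bar>fst p - fst q\<bar> \<le> b" "\<bar>fst (snd p) - fst (snd q)\<bar> \<le> b" "\<bar>snd (snd p) - snd (snd q)\<bar> \<le> b"
  then have b': "(a1 - a2)\<^sup>2 \<le> b\<^sup>2" "(b1 - b2)\<^sup>2 \<le> b\<^sup>2" "(e1 - e2)\<^sup>2 \<le> b\<^sup>2"
    by (simp_all add: p q abs_le_square_iff[symmetric])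
  have b0: "0 \<le> b" using b by linarith
  have "(dist p q)\<^sup>2 \<le> (9/5 * b)\<^sup>2"
  proof -
    have "(dist p q)\<^sup>2 \<le> 3 * b\<^sup>2" using b' unfolding D by linarith
    also have "\<dots> \<le> (9/5 * b)\<^sup>2" unfolding power_mult_distrib by (intro mult_right_mono) (auto simp: power2_eq_square)
    finally show ?thesis .
  qed
  then show "dist p q \<le> 9/5 * b" using b0 by (simp add: power2_le_iff_abs_le abs_le_square_iff[symmetric])
qed

lemma comp_diff:
  "\<bar>comp_alpha X y - comp_alpha Y y\<bar> \<le> dist X Y" "\<bar>comp_beta X y - comp_beta Y y\<bar> \<le> dist X Y" "\<bar>comp_eta X y - comp_eta Y y\<bar> \<le> dist X Y"
  "\<bar>ups (comp_alpha X) (comp_beta X) y - ups (comp_alpha Y) (comp_beta Y) y\<bar> \<le> 36/100 * dist X Y"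
  unfolding comp_alpha_def comp_beta_def comp_eta_def ups_def
  using dist_triple(1-4)[of "apply_bcontfun X y" "apply_bcontfun Y y"] dist_bounded[of X y Y] by linarith+

lemma continuous_comps: "continuous_on UNIV (comp_alpha X)" "continuous_on UNIV (comp_beta X)" "continuous_on UNIV (comp_eta X)"
  unfolding comp_alpha_def[abs_def] comp_beta_def[abs_def] comp_eta_def[abs_def] by (intro continuous_intros; simp)+

lemma near_cball:
  assumes "X \<in> cball X0 radius"
  shows "near (comp_alpha X) (comp_beta X) (comp_eta X)"
proof -
  have d: "dist X X0 \<le> radius" using assms by (simp add: dist_commute)
  have "\<bar>comp_alpha X y - 2/3\<bar> \<le> radius" "\<bar>comp_beta X y - 2/3\<bar> \<le> radius" "\<bar>comp_eta X y - 1/3\<bar> \<le> radius" for y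
    using comp_diff(1)[of X y X0] comp_diff(2)[of X y X0] comp_diff(3)[of X y X0] d
    unfolding X0_comps by linarith+
  then show ?thesis unfolding near_def using continuous_comps by blast
qed

text \<open>\<open>Bcontfun\<close> is meaningful only on bounded continuous functions. The new
  components are continuous because they are differentiable, and each is bounded by 1.\<close>

lemma step_comps:
  assumes n: "near (comp_alpha X) (comp_beta X) (comp_eta X)" and k: "kappa0 \<le> \<kappa>"
  shows "comp_alpha (step \<kappa> X) = newA \<kappa> (comp_alpha X) (comp_beta X) (comp_eta X)" "comp_beta (step \<kappa> X) = newB \<kappa> (comp_alpha X) (comp_beta X) (comp_eta X)"
    "comp_eta (step \<kappa> X) = newE \<kappa> (comp_alpha X) (comp_beta X) (comp_eta X)"
proof -
  let ?f = "\<lambda>y. (newA \<kappa> (comp_alpha X) (comp_beta X) (comp_eta X) y, newB \<kappa> (comp_alpha X) (comp_beta X) (comp_eta X) y, newE \<kappa> (comp_alpha X) (comp_beta X) (comp_eta X) y)"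
  have "?f \<in> bcontfun"
  proof (rule bcontfun_normI)
    show "continuous_on UNIV ?f"
      by (intro continuous_on_Pair newE(3)[OF n k]; rule DERIV_continuous_on[OF has_field_derivative_at_within])
         (rule newA(2)[OF n k] newB(1)[OF n k])+
    have "\<bar>newE \<kappa> (comp_alpha X) (comp_beta X) (comp_eta X) y\<bar> \<le> 1" for y using newE(2)[OF n k, of y] by linarith
    then show "norm (?f y) \<le> 9/5 * 1" for y
      using dist_triple(5)[of "?f y" "0" 1] newA(3)[OF n k, of y] newB(2)[OF n k, of y]
      by (simp add: dist_norm)
  qed
  then have "apply_bcontfun (step \<kappa> X) = ?f" unfolding step_def by (simp add: Bcontfun_inverse)
  then show "comp_alpha (step \<kappa> X) = newA \<kappa> (comp_alpha X) (comp_beta X) (comp_eta X)" "comp_beta (step \<kappa> X) = newB \<kappa> (comp_alpha X) (comp_beta X) (comp_eta X)"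
    "comp_eta (step \<kappa> X) = newE \<kappa> (comp_alpha X) (comp_beta X) (comp_eta X)"
    by (simp_all add: comp_alpha_def comp_beta_def comp_eta_def fun_eq_iff)
qed

lemma dist_state_le:
  assumes "\<And>y. \<bar>comp_alpha X y - comp_alpha Y y\<bar> \<le> b" "\<And>y. \<bar>comp_beta X y - comp_beta Y y\<bar> \<le> b" "\<And>y. \<bar>comp_eta X y - comp_eta Y y\<bar> \<le> b"
  shows "dist X Y \<le> 9/5 * b"
  using assms by (intro dist_bound dist_triple(5)) (auto simp: comp_alpha_def comp_beta_def comp_eta_def)

text \<open>Componentwise constants 5/10 and 8, times 9/5 for the Euclidean norm. Equal stiffnesses
  give the contraction, different ones the dependence on kappa.\<close>

lemma step_lipschitz:
  assumes X: "X \<in> cball X0 radius" "kappa0 \<le> \<kappa>1" and Y: "Y \<in> cball X0 radius" "kappa0 \<le> \<kappa>2"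
  shows "dist (step \<kappa>1 X) (step \<kappa>2 Y) \<le> 9/10 * dist X Y + 15 * \<bar>\<kappa>1 - \<kappa>2\<bar>"
proof -
  note n = near_cball[OF X(1)] near_cball[OF Y(1)]
  have "dist (step \<kappa>1 X) (step \<kappa>2 Y) \<le> 9/5 * (5/10 * dist X Y + 8 * \<bar>\<kappa>1 - \<kappa>2\<bar>)"
    by (intro dist_state_le; unfold step_comps[OF n(1) X(2)] step_comps[OF n(2) Y(2)])
       (intro step_diff n X Y comp_diff)+
  then show ?thesis by argo
qed

text \<open>At the base point all averages coincide and a = b, so eta does not move; in the sources
  of alpha and beta only the term of size (1 / kappa) |1 - 2 s| 2/3 remains.\<close>

lemma step_X0:
  assumes k: "kappa0 \<le> \<kappa>"
  shows "dist (step \<kappa> X0) X0 \<le> 9/5 * (1 / \<kappa>)"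
proof -
  have n: "near (comp_alpha X0) (comp_beta X0) (comp_eta X0)" by (rule near_cball) simp
  have c: "comp_alpha X0 = (\<lambda>_. 2/3)" "comp_beta X0 = (\<lambda>_. 2/3)" "comp_eta X0 = (\<lambda>_. 1/3)" by (auto simp: fun_eq_iff)
  have u: "ups (\<lambda>_. 2/3) (\<lambda>_. 2/3) = (\<lambda>_. 1/3)" by (simp add: ups_def[abs_def])
  have k0: "0 < \<kappa>" using k by simp
  have s: "continuous_on UNIV (srcE \<kappa> (comp_alpha X0) (comp_beta X0) (comp_eta X0))" "\<bar>srcE \<kappa> (comp_alpha X0) (comp_beta X0) (comp_eta X0) y - 1/3\<bar> \<le> 0" for y
    unfolding c srcE_def[abs_def] u by (simp_all add: avgI_const avgH_const avgN_const fE_def)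
  have E: "newE \<kappa> (comp_alpha X0) (comp_beta X0) (comp_eta X0) = (\<lambda>_. 1/3)"
    using bounded_sol_near(2)[OF rate_E s] by (auto simp: newE_def fun_eq_iff)
  have bd: "\<bar>1 - 2 * lg y\<bar> \<le> 1" for y using lg_bounds[of y] by (simp add: abs_le_iff)
  have A: "\<bar>srcA (1 / \<kappa>) (ups (comp_alpha X0) (comp_beta X0)) (comp_alpha X0) (\<lambda>_. 1/3) y - 2/3\<bar> \<le> 1 / \<kappa>" for y
    unfolding c srcA_def u using bd[of y] k0
    by (simp add: avgI_const avgH_const avgN_const fA_def abs_mult abs_divide divide_simps)
  have B: "\<bar>srcA (- (1 / \<kappa>)) (ups (comp_alpha X0) (comp_beta X0)) (comp_beta X0) (\<lambda>_. 1/3) y - 2/3\<bar> \<le> 1 / \<kappa>" for y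
    unfolding c srcA_def u using bd[of y] k0
    by (simp add: avgI_const avgH_const avgN_const fA_def abs_mult abs_divide divide_simps)
  have sA: "continuous_on UNIV (srcA (1 / \<kappa>) (ups (comp_alpha X0) (comp_beta X0)) (comp_alpha X0) (\<lambda>_. 1/3))"
    by (intro srcA[OF n] nearD[OF n] kinv k) auto
  have sB: "continuous_on UNIV (srcA (- (1 / \<kappa>)) (ups (comp_alpha X0) (comp_beta X0)) (comp_beta X0) (\<lambda>_. 1/3))"
    by (intro srcA[OF n] nearD[OF n] kinv k) auto
  have sA': "continuous_on UNIV (\<lambda>x. srcA (1 / \<kappa>) (ups (comp_alpha X0) (comp_beta X0)) (comp_alpha X0) (\<lambda>_. 1/3) (- x))"
    by (intro continuous_on_compose2[OF sA] continuous_intros) auto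
  show ?thesis
  proof (rule dist_state_le)
    fix y
    have "\<bar>newA \<kappa> (comp_alpha X0) (comp_beta X0) (comp_eta X0) y - 2/3\<bar> \<le> 1 / \<kappa>"
      unfolding newA_def E by (rule bounded_sol_near[OF const_rate[OF k0] sA' A])
    then show "\<bar>comp_alpha (step \<kappa> X0) y - comp_alpha X0 y\<bar> \<le> 1 / \<kappa>"
      unfolding step_comps[OF n k] by simp
    have "\<bar>newB \<kappa> (comp_alpha X0) (comp_beta X0) (comp_eta X0) y - 2/3\<bar> \<le> 1 / \<kappa>"
      unfolding newB_def E by (rule bounded_sol_near[OF const_rate[OF k0] sB B])
    then show "\<bar>comp_beta (step \<kappa> X0) y - comp_beta X0 y\<bar> \<le> 1 / \<kappa>"
      unfolding step_comps[OF n k] by simp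
    show "\<bar>comp_eta (step \<kappa> X0) y - comp_eta X0 y\<bar> \<le> 1 / \<kappa>"
      unfolding step_comps[OF n k] E using k0 by simp
  qed
qed

lemma fixed_point_exists:
  assumes k: "kappa0 \<le> \<kappa>"
  shows "\<exists>X. X \<in> cball X0 radius \<and> step \<kappa> X = X"
proof -
  have "\<exists>!X. X \<in> cball X0 radius \<and> step \<kappa> X = X"
  proof (rule Banach_fix)
    show "complete (cball X0 radius)" by (simp add: complete_eq_closed)
    show "step \<kappa> ` cball X0 radius \<subseteq> cball X0 radius"
    proof safe
      fix X assume X: "X \<in> cball X0 radius"
      have "dist (step \<kappa> X) X0 \<le> dist (step \<kappa> X) (step \<kappa> X0) + dist (step \<kappa> X0) X0" by (rule dist_triangle)
      also have "dist (step \<kappa> X) (step \<kappa> X0) \<le> 9/10 * dist X X0 + 15 * \<bar>\<kappa> - \<kappa>\<bar>"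
        by (intro step_lipschitz X k) simp
      also have "dist (step \<kappa> X0) X0 \<le> 9/5 * (1 / kappa0)" using step_X0[OF k] kinv(3)[OF k] by linarith
      finally show "step \<kappa> X \<in> cball X0 radius" using X by (simp add: dist_commute)
    qed
    show "dist (step \<kappa> X) (step \<kappa> Y) \<le> 9/10 * dist X Y" if "X \<in> cball X0 radius" "Y \<in> cball X0 radius" for X Y
      using step_lipschitz[OF that(1) k that(2) k] by simp
  qed auto
  then show ?thesis by blast
qed

definition fixpt :: "real \<Rightarrow> state" where
  "fixpt \<kappa> = (SOME X. X \<in> cball X0 radius \<and> step \<kappa> X = X)"

lemma fixpt:
  assumes "kappa0 \<le> \<kappa>"
  shows "fixpt \<kappa> \<in> cball X0 radius" "step \<kappa> (fixpt \<kappa>) = fixpt \<kappa>"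
  unfolding fixpt_def using someI_ex[OF fixed_point_exists[OF assms]] by auto

text \<open>The term 9/10 dist is absorbed on the left, and 15 becomes 150. The argument applies to
  any two fixed points in the ball, so continuity survives the choice made in
  \<open>fixpt\<close>.\<close>

lemma fixpt_lipschitz:
  assumes "kappa0 \<le> \<kappa>1" "kappa0 \<le> \<kappa>2"
  shows "dist (fixpt \<kappa>1) (fixpt \<kappa>2) \<le> 150 * \<bar>\<kappa>1 - \<kappa>2\<bar>"
  using step_lipschitz[OF fixpt(1)[OF assms(1)] assms(1) fixpt(1)[OF assms(2)] assms(2)]
  unfolding fixpt(2)[OF assms(1)] fixpt(2)[OF assms(2)] by argo

lemma fixpt_X0:
  assumes k: "kappa0 \<le> \<kappa>"
  shows "dist (fixpt \<kappa>) X0 \<le> 18 / \<kappa>"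
proof -
  have "dist (fixpt \<kappa>) X0 \<le> dist (step \<kappa> (fixpt \<kappa>)) (step \<kappa> X0) + dist (step \<kappa> X0) X0"
    using dist_triangle[of "fixpt \<kappa>" X0 "step \<kappa> X0"] unfolding fixpt(2)[OF k] .
  also have "dist (step \<kappa> (fixpt \<kappa>)) (step \<kappa> X0) \<le> 9/10 * dist (fixpt \<kappa>) X0 + 15 * \<bar>\<kappa> - \<kappa>\<bar>"
    by (intro step_lipschitz fixpt k) simp
  also have "dist (step \<kappa> X0) X0 \<le> 9/5 * (1 / \<kappa>)" by (rule step_X0[OF k])
  finally show ?thesis by simp
qed

section \<open>Scaling and reflection of the wave of unit speed\<close>

text \<open>P stands for q / l^2 = U'. The product rule leaves P C1 and - P C2 in the two
  concentration equations; combined with the exchange term f, exactly one of them is left with a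
  multiple of C1 - C2, which one depending on the sign of P.\<close>

lemma ipm_solution_profile:
  fixes l v :: real
  assumes l: "l > 0"
    and C1: "\<And>x. (C1 has_real_derivative G1 x) (at x)"
    and C2: "\<And>x. (C2 has_real_derivative G2 x) (at x)"
    and G1: "\<And>x. (G1 has_real_derivative (U x - v) * G1 x + max (P x) 0 * (C1 x - C2 x)) (at x)"
    and G2: "\<And>x. (G2 has_real_derivative - (U x + v) * G2 x + min (P x) 0 * (C1 x - C2 x)) (at x)"
    and U: "\<And>x. (U has_real_derivative P x) (at x)"
    and P: "\<And>x. ((\<lambda>x. l\<^sup>2 * P x) has_real_derivative 2 * U x + C1 x - C2 x) (at x)"
  shows "ipm_solution l (\<lambda>t y. C1 (y - v * t)) (\<lambda>t y. C2 (y - v * t)) (\<lambda>t y. U (y - v * t))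
     (\<lambda>t y. - U (y - v * t)) (\<lambda>t y. l\<^sup>2 * P (y - v * t))"
proof -
  have space: "((\<lambda>y. F (y - v * t)) has_real_derivative F' (y - v * t)) (at y)"
    if "\<And>x. (F has_real_derivative F' x) (at x)" for F F' t y
  proof -
    have "((\<lambda>y. y - v * t) has_real_derivative 1) (at y)" by (auto intro!: derivative_eq_intros)
    from DERIV_chain2[OF that this] show ?thesis by simp
  qed
  have time: "((\<lambda>s. F (y - v * s)) has_real_derivative - v * F' (y - v * t)) (at t within {0..})"
    if "\<And>x. (F has_real_derivative F' x) (at x)" for F F' t y
  proof -
    have "((\<lambda>s. y - v * s) has_real_derivative - v) (at t within {0..})" by (auto intro!: derivative_eq_intros)
    from DERIV_chain2[OF that this] show ?thesis by (simp add: mult.commute)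
  qed
  have dC1: "deriv (\<lambda>y. C1 (y - v * t)) = (\<lambda>y. G1 (y - v * t))"
    and dC2: "deriv (\<lambda>y. C2 (y - v * t)) = (\<lambda>y. G2 (y - v * t))" for t
    using space[OF C1] space[OF C2] by (auto simp: fun_eq_iff intro!: DERIV_imp_deriv)
  \<comment> \<open>Here u_T = - l p, so the two cases of f are the cases p <= 0 and p >= 0; at p =
    0 they agree because both vanish.\<close>
  have f: "ipm_f l a b (l\<^sup>2 * p) = - min p 0 * a - max p 0 * b" for a b p
  proof -
    have "- (l\<^sup>2 * p) / l = - (l * p)" using l by (simp add: power2_eq_square)
    moreover have "- (l * p) \<ge> 0 \<longleftrightarrow> p \<le> 0" using l by (simp add: mult_le_0_iff)
    ultimately show ?thesis using l by (auto simp: ipm_f_def Let_def min_def max_def)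
  qed
  \<comment> \<open>Leaves the three derivatives open until the derivative rules determine
    them.\<close>
  have ex: "\<exists>a b d. A a \<and> B b \<and> S \<and> D d \<and> a + b - d = r"
    if "A a" "B b" S "D d" "a + b - d = r" for A B D :: "real \<Rightarrow> bool" and S a b d r
    using that by blast
  show ?thesis
    unfolding ipm_solution_def
  proof (intro allI impI conjI)
    fix t y :: real
    let ?x = "y - v * t"
    have max_eq: "max (P ?x) 0 = P ?x - min (P ?x) 0" by (simp add: min_def max_def)
    have p1: "((\<lambda>z. U (z - v * t) * C1 (z - v * t)) has_real_derivative P ?x * C1 ?x + G1 ?x * U ?x) (at y)"
      by (rule DERIV_mult[OF space[OF U] space[OF C1]])
    have p2: "((\<lambda>z. - U (z - v * t) * C2 (z - v * t)) has_real_derivative - P ?x * C2 ?x + G2 ?x * - U ?x) (at y)"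
      by (rule DERIV_mult[OF DERIV_minus[OF space[OF U]] space[OF C2]])
    show "\<exists>a b d. ((\<lambda>s. C1 (y - v * s)) has_real_derivative a) (at t within {0..}) \<and>
        ((\<lambda>z. U (z - v * t) * C1 (z - v * t)) has_real_derivative b) (at y) \<and>
        (\<forall>z. (\<lambda>w. C1 (w - v * t)) differentiable (at z)) \<and>
        (deriv (\<lambda>w. C1 (w - v * t)) has_real_derivative d) (at y) \<and>
        a + b - d = - ipm_f l (C1 ?x) (C2 ?x) (l\<^sup>2 * P ?x)"
      unfolding dC1 f
    proof (rule ex)
      show "\<forall>z. (\<lambda>w. C1 (w - v * t)) differentiable (at z)"
        using space[OF C1] real_differentiable_def by blast
      show "- v * G1 ?x + (P ?x * C1 ?x + G1 ?x * U ?x) - ((U ?x - v) * G1 ?x + max (P ?x) 0 * (C1 ?x - C2 ?x))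
          = - (- min (P ?x) 0 * C1 ?x - max (P ?x) 0 * C2 ?x)"
        by (simp add: max_eq algebra_simps)
    qed (rule time[OF C1] p1 space[OF G1])+
    show "\<exists>a b d. ((\<lambda>s. C2 (y - v * s)) has_real_derivative a) (at t within {0..}) \<and>
        ((\<lambda>z. - U (z - v * t) * C2 (z - v * t)) has_real_derivative b) (at y) \<and>
        (\<forall>z. (\<lambda>w. C2 (w - v * t)) differentiable (at z)) \<and>
        (deriv (\<lambda>w. C2 (w - v * t)) has_real_derivative d) (at y) \<and>
        a + b - d = ipm_f l (C1 ?x) (C2 ?x) (l\<^sup>2 * P ?x)"
      unfolding dC2 f
    proof (rule ex)
      show "\<forall>z. (\<lambda>w. C2 (w - v * t)) differentiable (at z)"
        using space[OF C2] real_differentiable_def by blast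
      show "- v * G2 ?x + (- P ?x * C2 ?x + G2 ?x * - U ?x) - (- (U ?x + v) * G2 ?x + min (P ?x) 0 * (C1 ?x - C2 ?x))
          = - min (P ?x) 0 * C1 ?x - max (P ?x) 0 * C2 ?x"
        by (simp add: max_eq algebra_simps)
    qed (rule time[OF C2] p2 space[OF G2])+
    show "((\<lambda>z. l\<^sup>2 * P (z - v * t)) has_real_derivative U ?x - - U ?x + C1 ?x - C2 ?x) (at y)"
      using space[OF P, of t y] by simp
    show "((\<lambda>z. U (z - v * t)) has_real_derivative l\<^sup>2 * P ?x / l\<^sup>2) (at y)"
      using space[OF U, of t y] l by simp
  qed simp
qed

text \<open>At +infinity the equation for V forces U = - (W1 - W2) / 2, so two numbers M and m =
  -U(+infinity) describe the whole end state; the limit M - 2 m of W2 encodes this relation.\<close>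

definition unit_wave :: "real \<Rightarrow> real \<Rightarrow> real \<Rightarrow> (real \<Rightarrow> real) \<Rightarrow> (real \<Rightarrow> real) \<Rightarrow> (real \<Rightarrow> real) \<Rightarrow>
    (real \<Rightarrow> real) \<Rightarrow> (real \<Rightarrow> real) \<Rightarrow> (real \<Rightarrow> real) \<Rightarrow> bool" where
  "unit_wave \<kappa> M m W1 W2 G H U V \<longleftrightarrow>
     (\<forall>x. (W1 has_real_derivative G x) (at x) \<and> (W2 has_real_derivative H x) (at x) \<and>
        (G has_real_derivative (1 + U x) * G x) (at x) \<and>
        (H has_real_derivative (1 - U x) * H x - V x * (W1 x - W2 x)) (at x) \<and>
        (U has_real_derivative - V x) (at x) \<and>
        (V has_real_derivative - \<kappa>\<^sup>2 * (U x + (W1 x - W2 x) / 2)) (at x) \<and> 0 \<le> V x) \<and>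
     (W1 \<longlongrightarrow> 0) at_bot \<and> (W2 \<longlongrightarrow> 0) at_bot \<and> (U \<longlongrightarrow> 0) at_bot \<and> (V \<longlongrightarrow> 0) at_bot \<and>
     (W1 \<longlongrightarrow> M) at_top \<and> (W2 \<longlongrightarrow> M - 2 * m) at_top \<and> (U \<longlongrightarrow> - m) at_top \<and> (V \<longlongrightarrow> 0) at_top"

lemma DERIV_continuous_UNIV:
  fixes f :: "real \<Rightarrow> real"
  assumes "\<And>x. (f has_real_derivative f' x) (at x)"
  shows "continuous_on UNIV f"
  by (rule DERIV_continuous_on[OF has_field_derivative_at_within[OF assms]])

lemma DERIV_scale:
  assumes "\<And>x. (F has_real_derivative F' x) (at x)"
  shows "((\<lambda>x. F (c * x)) has_real_derivative c * F' (c * x)) (at (x::real))"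
proof -
  have "((\<lambda>x. c * x) has_real_derivative c) (at x)" by (auto intro!: derivative_eq_intros)
  from DERIV_chain2[OF assms this] show ?thesis by (simp add: mult.commute)
qed

lemma scale_filters:
  fixes c :: real
  assumes "c > 0"
  shows "filterlim (\<lambda>x. c * x) at_top at_top" "filterlim (\<lambda>x. c * x) at_bot at_bot"
    "filterlim (\<lambda>x. - c * x) at_top at_bot" "filterlim (\<lambda>x. - c * x) at_bot at_top"
proof -
  show 1: "filterlim (\<lambda>x. c * x) at_top at_top" "filterlim (\<lambda>x. c * x) at_bot at_bot"
    using assms by (auto intro!: filterlim_tendsto_pos_mult_at_top[OF tendsto_const] filterlim_ident
        filterlim_tendsto_pos_mult_at_bot[OF tendsto_const])
  show "filterlim (\<lambda>x. - c * x) at_top at_bot" "filterlim (\<lambda>x. - c * x) at_bot at_top"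
    using filterlim_compose[OF filterlim_uminus_at_top_at_bot 1(2)]
      filterlim_compose[OF filterlim_uminus_at_bot_at_top 1(1)] by simp_all
qed

lemma unit_waveD:
  assumes "unit_wave \<kappa> M m W1 W2 G H U V"
  shows "\<And>x. (W1 has_real_derivative G x) (at x)" "\<And>x. (W2 has_real_derivative H x) (at x)"
    "\<And>x. (G has_real_derivative (1 + U x) * G x) (at x)"
    "\<And>x. (H has_real_derivative (1 - U x) * H x - V x * (W1 x - W2 x)) (at x)"
    "\<And>x. (U has_real_derivative - V x) (at x)"
    "\<And>x. (V has_real_derivative - \<kappa>\<^sup>2 * (U x + (W1 x - W2 x) / 2)) (at x)" "\<And>x. 0 \<le> V x"
    "(W1 \<longlongrightarrow> 0) at_bot" "(W2 \<longlongrightarrow> 0) at_bot" "(U \<longlongrightarrow> 0) at_bot" "(V \<longlongrightarrow> 0) at_bot"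
    "(W1 \<longlongrightarrow> M) at_top" "(W2 \<longlongrightarrow> M - 2 * m) at_top" "(U \<longlongrightarrow> - m) at_top" "(V \<longlongrightarrow> 0) at_top"
  using assms unfolding unit_wave_def by blast+

text \<open>The scaling multiplies P' by c^3 and 2 U + C1 - C2 by c, so the equation for q holds
  exactly when kappa^2 (c l)^2 = 2. The end velocity is - c m, half of the difference of the two end
  concentrations.\<close>

lemma traveling_wave_neg:
  assumes w: "unit_wave \<kappa> M m W1 W2 G H U V" and l: "0 < l" and c: "0 < c" and k: "\<kappa>\<^sup>2 * (c * l)\<^sup>2 = 2"
  shows "ipm_traveling_wave l (- c) (-1, -1, 0, 0, 0) (- 1 + c * M, - 1 + c * (M - 2 * m), - c * m, c * m, 0)"
proof -
  note w = unit_waveD[OF w]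
  let ?C1 = "\<lambda>x. - 1 + c * W1 (c * x)" and ?C2 = "\<lambda>x. - 1 + c * W2 (c * x)"
    and ?U = "\<lambda>x. c * U (c * x)" and ?P = "\<lambda>x. - (c\<^sup>2) * V (c * x)"
    and ?G1 = "\<lambda>x. c\<^sup>2 * G (c * x)" and ?G2 = "\<lambda>x. c\<^sup>2 * H (c * x)"
  \<comment> \<open>V >= 0 means u_T >= 0 everywhere: f stays in its c1 case and the equation for C1
    carries no coupling term.\<close>
  have P: "?P x \<le> 0" "max (?P x) 0 = 0" "min (?P x) 0 = ?P x" for x using w(7)[of "c * x"] by auto
  have dC1: "(?C1 has_real_derivative ?G1 x) (at x)" for x
    by (rule derivative_eq_intros refl DERIV_scale[OF w(1)])+ (simp add: power2_eq_square)
  have dC2: "(?C2 has_real_derivative ?G2 x) (at x)" for x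
    by (rule derivative_eq_intros refl DERIV_scale[OF w(2)])+ (simp add: power2_eq_square)
  have dG1: "(?G1 has_real_derivative (?U x - - c) * ?G1 x + max (?P x) 0 * (?C1 x - ?C2 x)) (at x)" for x
    unfolding P by (rule derivative_eq_intros refl DERIV_scale[OF w(3)])+ (simp add: power2_eq_square algebra_simps)
  have dG2: "(?G2 has_real_derivative - (?U x + - c) * ?G2 x + min (?P x) 0 * (?C1 x - ?C2 x)) (at x)" for x
    unfolding P by (rule derivative_eq_intros refl DERIV_scale[OF w(4)])+ (simp add: power2_eq_square algebra_simps)
  have dU: "(?U has_real_derivative ?P x) (at x)" for x
    by (rule derivative_eq_intros refl DERIV_scale[OF w(5)])+ (simp add: power2_eq_square)
  have dP: "((\<lambda>x. l\<^sup>2 * ?P x) has_real_derivative 2 * ?U x + ?C1 x - ?C2 x) (at x)" for x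
  proof -
    have "((\<lambda>x. l\<^sup>2 * ?P x) has_real_derivative
      c * (\<kappa>\<^sup>2 * (c * l)\<^sup>2) * (U (c * x) + (W1 (c * x) - W2 (c * x)) / 2)) (at x)"
      by (rule derivative_eq_intros refl DERIV_scale[OF w(6)])+ (simp add: power2_eq_square algebra_simps)
    moreover have "c * 2 * (U (c * x) + (W1 (c * x) - W2 (c * x)) / 2) = 2 * ?U x + ?C1 x - ?C2 x"
      by (simp add: field_simps)
    ultimately show ?thesis unfolding k by (simp only:)
  qed
  note bot = filterlim_compose[OF _ scale_filters(2)[OF c]] and top = filterlim_compose[OF _ scale_filters(1)[OF c]]
  have "ipm_traveling_wave l (- c) (- 1 + c * 0, - 1 + c * 0, c * 0, - (c * 0), l\<^sup>2 * (- (c\<^sup>2) * 0))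
    (- 1 + c * M, - 1 + c * (M - 2 * m), c * - m, - (c * - m), l\<^sup>2 * (- (c\<^sup>2) * 0))"
    unfolding ipm_traveling_wave_def
  proof (intro exI conjI)
    show "ipm_solution l (\<lambda>t y. ?C1 (y - - c * t)) (\<lambda>t y. ?C2 (y - - c * t)) (\<lambda>t y. ?U (y - - c * t))
     (\<lambda>t y. - ?U (y - - c * t)) (\<lambda>t y. l\<^sup>2 * ?P (y - - c * t))"
      by (rule ipm_solution_profile[OF l dC1 dC2 dG1 dG2 dU dP])
    show "continuous_on UNIV (\<lambda>x. (?C1 x, ?C2 x, ?U x, - ?U x, l\<^sup>2 * ?P x))"
      by (intro continuous_on_Pair continuous_on_minus DERIV_continuous_UNIV[OF dC1] DERIV_continuous_UNIV[OF dC2]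
          DERIV_continuous_UNIV[OF dU] DERIV_continuous_UNIV[OF dP])
    show "((\<lambda>x. (?C1 x, ?C2 x, ?U x, - ?U x, l\<^sup>2 * ?P x)) \<longlongrightarrow>
        (- 1 + c * 0, - 1 + c * 0, c * 0, - (c * 0), l\<^sup>2 * (- (c\<^sup>2) * 0))) at_bot"
      by (intro tendsto_intros bot w)
    show "((\<lambda>x. (?C1 x, ?C2 x, ?U x, - ?U x, l\<^sup>2 * ?P x)) \<longlongrightarrow>
        (- 1 + c * M, - 1 + c * (M - 2 * m), c * - m, - (c * - m), l\<^sup>2 * (- (c\<^sup>2) * 0))) at_top"
      by (intro tendsto_intros top w)
  qed
  then show ?thesis by simp
qed

text \<open>The system is invariant under y -> -y, c1 -> -c2, c2 -> -c1, q -> -q with u1 and u2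
  kept; the speed changes sign and the two ends are exchanged. Hence W1 and W2 swap roles, P becomes
  nonnegative and f stays in its c2 case.\<close>

lemma traveling_wave_pos:
  assumes w: "unit_wave \<kappa> M m W1 W2 G H U V" and l: "0 < l" and c: "0 < c" and k: "\<kappa>\<^sup>2 * (c * l)\<^sup>2 = 2"
  shows "ipm_traveling_wave l c (1 - c * (M - 2 * m), 1 - c * M, - c * m, c * m, 0) (1, 1, 0, 0, 0)"
proof -
  note w = unit_waveD[OF w]
  let ?C1 = "\<lambda>x. 1 - c * W2 (- c * x)" and ?C2 = "\<lambda>x. 1 - c * W1 (- c * x)"
    and ?U = "\<lambda>x. c * U (- c * x)" and ?P = "\<lambda>x. c\<^sup>2 * V (- c * x)"
    and ?G1 = "\<lambda>x. c\<^sup>2 * H (- c * x)" and ?G2 = "\<lambda>x. c\<^sup>2 * G (- c * x)"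
  have P: "0 \<le> ?P x" "max (?P x) 0 = ?P x" "min (?P x) 0 = 0" for x using w(7)[of "- c * x"] by auto
  have dC1: "(?C1 has_real_derivative ?G1 x) (at x)" for x
    by (rule derivative_eq_intros refl DERIV_scale[OF w(2)])+ (simp add: power2_eq_square)
  have dC2: "(?C2 has_real_derivative ?G2 x) (at x)" for x
    by (rule derivative_eq_intros refl DERIV_scale[OF w(1)])+ (simp add: power2_eq_square)
  have dG1: "(?G1 has_real_derivative (?U x - c) * ?G1 x + max (?P x) 0 * (?C1 x - ?C2 x)) (at x)" for x
    unfolding P by (rule derivative_eq_intros refl DERIV_scale[OF w(4)])+ (simp add: power2_eq_square algebra_simps)
  have dG2: "(?G2 has_real_derivative - (?U x + c) * ?G2 x + min (?P x) 0 * (?C1 x - ?C2 x)) (at x)" for x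
    unfolding P by (rule derivative_eq_intros refl DERIV_scale[OF w(3)])+ (simp add: power2_eq_square algebra_simps)
  have dU: "(?U has_real_derivative ?P x) (at x)" for x
    by (rule derivative_eq_intros refl DERIV_scale[OF w(5)])+ (simp add: power2_eq_square)
  have dP: "((\<lambda>x. l\<^sup>2 * ?P x) has_real_derivative 2 * ?U x + ?C1 x - ?C2 x) (at x)" for x
  proof -
    have "((\<lambda>x. l\<^sup>2 * ?P x) has_real_derivative
      c * (\<kappa>\<^sup>2 * (c * l)\<^sup>2) * (U (- c * x) + (W1 (- c * x) - W2 (- c * x)) / 2)) (at x)"
      by (rule derivative_eq_intros refl DERIV_scale[OF w(6)])+ (simp add: power2_eq_square algebra_simps)
    moreover have "c * 2 * (U (- c * x) + (W1 (- c * x) - W2 (- c * x)) / 2) = 2 * ?U x + ?C1 x - ?C2 x"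
      by (simp add: field_simps)
    ultimately show ?thesis unfolding k by (simp only:)
  qed
  note bot = filterlim_compose[OF _ scale_filters(3)[OF c]] and top = filterlim_compose[OF _ scale_filters(4)[OF c]]
  have "ipm_traveling_wave l c (1 - c * (M - 2 * m), 1 - c * M, c * - m, - (c * - m), l\<^sup>2 * (c\<^sup>2 * 0))
    (1 - c * 0, 1 - c * 0, c * 0, - (c * 0), l\<^sup>2 * (c\<^sup>2 * 0))"
    unfolding ipm_traveling_wave_def
  proof (intro exI conjI)
    show "ipm_solution l (\<lambda>t y. ?C1 (y - c * t)) (\<lambda>t y. ?C2 (y - c * t)) (\<lambda>t y. ?U (y - c * t))
     (\<lambda>t y. - ?U (y - c * t)) (\<lambda>t y. l\<^sup>2 * ?P (y - c * t))"
      by (rule ipm_solution_profile[OF l dC1 dC2 dG1 dG2 dU dP])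
    show "continuous_on UNIV (\<lambda>x. (?C1 x, ?C2 x, ?U x, - ?U x, l\<^sup>2 * ?P x))"
      by (intro continuous_on_Pair continuous_on_minus DERIV_continuous_UNIV[OF dC1] DERIV_continuous_UNIV[OF dC2]
          DERIV_continuous_UNIV[OF dU] DERIV_continuous_UNIV[OF dP])
    show "((\<lambda>x. (?C1 x, ?C2 x, ?U x, - ?U x, l\<^sup>2 * ?P x)) \<longlongrightarrow>
        (1 - c * (M - 2 * m), 1 - c * M, c * - m, - (c * - m), l\<^sup>2 * (c\<^sup>2 * 0))) at_bot"
      by (intro tendsto_intros bot w)
    show "((\<lambda>x. (?C1 x, ?C2 x, ?U x, - ?U x, l\<^sup>2 * ?P x)) \<longlongrightarrow>
        (1 - c * 0, 1 - c * 0, c * 0, - (c * 0), l\<^sup>2 * (c\<^sup>2 * 0))) at_top"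
      by (intro tendsto_intros top w)
  qed
  then show ?thesis by simp
qed

section \<open>The wave of unit speed\<close>

text \<open>Y is the inverse of a primitive T of p. The growth T y' - T y >= c (y' - y) makes T
  onto, Y Lipschitz, and both limits infinite. With p = n / h this turns logistic time into
  position: ds/dx = G / M and ds/dy = s (1 - s) give dy/dx = h / n.\<close>

lemma time_change:
  fixes p :: "real \<Rightarrow> real"
  assumes p: "continuous_on UNIV p" "\<And>y. c \<le> p y" and c: "0 < c"
  shows "\<exists>Y. (\<forall>x. (Y has_real_derivative 1 / p (Y x)) (at x)) \<and> filterlim Y at_top at_top \<and> filterlim Y at_bot at_bot"
proof -
  obtain T where T: "\<And>y. (T has_real_derivative p y) (at y)" using antiderivative_exists[OF p(1)] by blast
  have pos: "0 < p y" for y using p(2)[of y] c by linarith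
  have "mono (\<lambda>y. T y - c * y)"
    by (rule DERIV_mono[of _ "\<lambda>y. p y - c"]) (use p(2) in \<open>auto intro!: derivative_eq_intros T\<close>)
  then have grow: "c * (y' - y) \<le> T y' - T y" if "y \<le> y'" for y y'
    using monoD[OF _ that, of "\<lambda>y. T y - c * y"] by (simp add: algebra_simps)
  have cont: "continuous_on UNIV T" by (rule DERIV_continuous_UNIV[OF T])
  have surj: "\<exists>y. T y = x" for x
  proof -
    define r where "r = \<bar>x - T 0\<bar> / c"
    have r: "0 \<le> r" "c * r = \<bar>x - T 0\<bar>" using c by (simp_all add: r_def)
    have "T (- r) \<le> x" "x \<le> T r" using grow[of "- r" 0] grow[of 0 r] r by auto
    then show ?thesis using IVT'[of T "- r" x r] r continuous_on_subset[OF cont] by auto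
  qed
  define Y where "Y x = (SOME y. T y = x)" for x
  have TY: "T (Y x) = x" for x unfolding Y_def using someI_ex[OF surj[of x]] .
  have le: "Y x \<le> y \<longleftrightarrow> x \<le> T y" for x y
  proof (cases "Y x \<le> y")
    case True
    then have "0 \<le> c * (y - Y x)" using c by simp
    with grow[OF True] TY[of x] True show ?thesis by simp
  next
    case False
    then have "0 < c * (Y x - y)" "y \<le> Y x" using c by simp_all
    with grow[of y "Y x"] TY[of x] False show ?thesis by simp
  qed
  have lip: "\<bar>Y x - Y x'\<bar> \<le> \<bar>x - x'\<bar> / c" for x x'
  proof -
    have "c * \<bar>Y x - Y x'\<bar> \<le> \<bar>x - x'\<bar>"
      using grow[of "Y x" "Y x'"] grow[of "Y x'" "Y x"] TY by (cases "Y x \<le> Y x'") auto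
    then show ?thesis using c by (simp add: pos_le_divide_eq mult.commute)
  qed
  have "isCont Y x" for x
  proof -
    have "((\<lambda>x'. \<bar>x' - x\<bar> / c) \<longlongrightarrow> \<bar>x - x\<bar> / c) (at x)" using c by (intro tendsto_intros) auto
    then have z: "((\<lambda>x'. \<bar>x' - x\<bar> / c) \<longlongrightarrow> 0) (at x)" by simp
    have "\<forall>\<^sub>F x' in at x. norm (Y x' - Y x) \<le> \<bar>x' - x\<bar> / c"
      unfolding real_norm_def by (rule always_eventually, rule allI, rule lip)
    from Lim_null_comparison[OF this z] have "((\<lambda>x'. Y x' - Y x) \<longlongrightarrow> 0) (at x)" .
    then show ?thesis unfolding isCont_def by (rule LIM_zero_cancel)
  qed
  then have isc: "isCont Y x" for x .
  have "(Y has_real_derivative inverse (p (Y x))) (at x)" for x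
    by (rule DERIV_inverse_function[of T _ _ _ "x - 1" "x + 1"])
       (use T pos[of "Y x"] TY isc in auto)
  then have "(Y has_real_derivative 1 / p (Y x)) (at x)" for x by (simp add: inverse_eq_divide)
  moreover have "filterlim Y at_top at_top"
    unfolding filterlim_at_top eventually_at_top_linorder
  proof (intro allI exI impI)
    fix Z x assume x: "T Z \<le> x"
    show "Z \<le> Y x"
    proof (rule ccontr)
      assume "\<not> Z \<le> Y x"
      then have "0 < c * (Z - Y x)" "Y x \<le> Z" using c by simp_all
      with grow[of "Y x" Z] TY[of x] x show False by simp
    qed
  qed
  moreover have "filterlim Y at_bot at_bot"
    unfolding filterlim_at_bot eventually_at_bot_linorder
    using le by blast
  ultimately show ?thesis by blast
qed

section \<open>Returning from logistic time to position\<close>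

lemma rescale_alpha:
  assumes "n \<noteq> 0" "h \<noteq> 0" "\<kappa> \<noteq> (0::real)"
  shows "h / n * (- \<kappa> * (a - fA (1 / \<kappa>) s i h n a e)) = - (\<kappa> + 1 - 2 * (s * i) / n) * a + \<kappa> * (1 - e)"
proof -
  \<comment> \<open>With theta = 2 s i / n and G' = (1 - theta) G, the identity to be reached says
    that A = alpha G satisfies A' = -kappa (A - D'), where D' = (1 - eta) G.\<close>
  have "h / n * (a - fA (1 / \<kappa>) s i h n a e) = (a - (1 - e)) + (1 / \<kappa>) * ((1 - 2 * (s * i) / n) * a)"
    using assms unfolding fA_def by (simp add: field_simps)
  then have "h / n * (- \<kappa> * (a - fA (1 / \<kappa>) s i h n a e)) = - \<kappa> * ((a - (1 - e)) + (1 / \<kappa>) * ((1 - 2 * (s * i) / n) * a))"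
    by (metis mult.left_commute)
  also have "\<dots> = - (\<kappa> + 1 - 2 * (s * i) / n) * a + \<kappa> * (1 - e)" using assms by (simp add: field_simps)
  finally show ?thesis .
qed

lemma rescale_beta:
  assumes "n \<noteq> 0" "h \<noteq> 0" "\<kappa> \<noteq> (0::real)"
  shows "h / n * (\<kappa> * (b - fA (- (1 / \<kappa>)) s i h n b e)) = (\<kappa> - 1 + 2 * (s * i) / n) * b - \<kappa> * (1 - e)"
proof -
  have "h / n * (b - fA (- (1 / \<kappa>)) s i h n b e) = (b - (1 - e)) - (1 / \<kappa>) * ((1 - 2 * (s * i) / n) * b)"
    using assms unfolding fA_def by (simp add: field_simps)
  then have "h / n * (\<kappa> * (b - fA (- (1 / \<kappa>)) s i h n b e)) = \<kappa> * ((b - (1 - e)) - (1 / \<kappa>) * ((1 - 2 * (s * i) / n) * b))"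
    by (metis mult.left_commute)
  also have "\<dots> = (\<kappa> - 1 + 2 * (s * i) / n) * b - \<kappa> * (1 - e)" using assms by (simp add: field_simps)
  finally show ?thesis .
qed

text \<open>The right side is 2 theta e - D u: the large bracket is D, with G = (2 / n) s (1 - s) (h
  / n). Solving for \<open>fE\<close> divides by 4 s, which is harmless at s = 0 because both theta
  and G carry a factor s.\<close>

lemma rescale_eta:
  assumes "n \<noteq> 0" "h \<noteq> 0" "\<kappa> \<noteq> (0::real)"
  shows "h / n * (4 * s * (e - fE (1 / \<kappa>) s i h n a b e)) = 2 * (2 * (s * i) / n) * e
    - (2 * (2 * (s * i) / n) + 2 / n * (s * (1 - s)) * (h / n) * (a - b) / (2 * \<kappa>)) * ((a + b) / 4)"
proof -
  define u where "u = (a + b) / 4"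
  have "h * (e - fE (1 / \<kappa>) s i h n a b e) = i * (e - u) - (1 - s) / 4 * (1 / \<kappa>) * (a - b) * u / n * h"
    using assms unfolding fE_def u_def[symmetric] by (simp add: field_simps)
  then have "h / n * (4 * s * (e - fE (1 / \<kappa>) s i h n a b e))
    = 4 * s / n * (i * (e - u) - (1 - s) / 4 * (1 / \<kappa>) * (a - b) * u / n * h)"
    by (metis (no_types, lifting) mult.commute mult.left_commute times_divide_eq_left)
  also have "\<dots> = 2 * (2 * (s * i) / n) * e
    - (2 * (2 * (s * i) / n) + 2 / n * (s * (1 - s)) * (h / n) * (a - b) / (2 * \<kappa>)) * u"
    using assms by (simp add: field_simps)
  finally show ?thesis unfolding u_def .
qed

lemma null_mult_bounded:
  fixes f g :: "real \<Rightarrow> real"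
  assumes "(f \<longlongrightarrow> 0) F" "\<And>y. \<bar>g y\<bar> \<le> B"
  shows "((\<lambda>y. f y * g y) \<longlongrightarrow> 0) F"
proof (rule Lim_null_comparison)
  show "((\<lambda>y. \<bar>f y\<bar> * B) \<longlongrightarrow> 0) F"
    using tendsto_mult_right[OF tendsto_rabs_zero[OF assms(1)], of B] by simp
  show "\<forall>\<^sub>F y in F. norm (f y * g y) \<le> \<bar>f y\<bar> * B"
    using assms(2) by (auto intro!: always_eventually mult_left_mono simp: abs_mult)
qed

definition wave_ups :: "real \<Rightarrow> real \<Rightarrow> real" where "wave_ups \<kappa> = ups (comp_alpha (fixpt \<kappa>)) (comp_beta (fixpt \<kappa>))"
definition wave_height :: "real \<Rightarrow> real" where "wave_height \<kappa> = 2 / avgN (wave_ups \<kappa>)"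
text \<open>The value of theta = -U at s = 1, that is, the number m of the wave.\<close>

definition wave_depth :: "real \<Rightarrow> real" where "wave_depth \<kappa> = wave_height \<kappa> * total (wave_ups \<kappa>)"

lemma unit_wave_exists:
  assumes k: "kappa0 \<le> \<kappa>"
  shows "\<exists>W1 W2 G H U V. unit_wave \<kappa> (wave_height \<kappa>) (wave_depth \<kappa>) W1 W2 G H U V"
proof -
  define \<alpha> \<beta> \<eta> where "\<alpha> = comp_alpha (fixpt \<kappa>)" and "\<beta> = comp_beta (fixpt \<kappa>)" and "\<eta> = comp_eta (fixpt \<kappa>)"
  have near: "near \<alpha> \<beta> \<eta>" unfolding \<alpha>_def \<beta>_def \<eta>_def by (rule near_cball[OF fixpt(1)[OF k]])
  have fixd: "newA \<kappa> \<alpha> \<beta> \<eta> = \<alpha>" "newB \<kappa> \<alpha> \<beta> \<eta> = \<beta>" "newE \<kappa> \<alpha> \<beta> \<eta> = \<eta>"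
    using step_comps[OF near[unfolded \<alpha>_def \<beta>_def \<eta>_def] k]
    unfolding fixpt(2)[OF k] \<alpha>_def \<beta>_def \<eta>_def by simp_all
  define u where "u = ups \<alpha> \<beta>"
  have wave_ups: "wave_ups \<kappa> = u" unfolding wave_ups_def u_def \<alpha>_def \<beta>_def ..
  define n where "n = avgN u"
  have n: "0 < n" using avgH_pos(2)[OF near] by (simp add: n_def u_def)
  have bcu: "bounded_cont u" using near_ups(2)[OF near] by (simp add: u_def)
  define hh where "hh = avgH u"
  have hh: "33/100 < hh y" "hh y \<le> 34/100" for y
    using avgH_pos(1)[OF near, of y] near_ups(4)[OF near, of y] unfolding hh_def u_def by linarith+
  have u: "0 \<le> u y" "\<bar>u y\<bar> \<le> 1" for y using near_ups(1)[OF near, of y] unfolding u_def by linarith+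
  have k0: "\<kappa> \<noteq> 0" using k by auto
  define \<theta> where "\<theta> y = wave_height \<kappa> * cum u y" for y
  define G where "G y = wave_height \<kappa> * (slope y * (hh y / n))" for y
  \<comment> \<open>From V = (alpha + beta) G / 4 and its splitting, V' = kappa (beta - alpha) G /
    4; the equation for V then leaves D = 2 theta - 2 V' / kappa^2. Taking this as the definition
    makes W2 = W1 - D, and its derivative has to be checked afterwards.\<close>
  define D where "D y = 2 * \<theta> y + G y * ((\<alpha> y - \<beta> y) / (2 * \<kappa>))" for y
  have M: "wave_height \<kappa> = 2 / n" by (simp add: wave_height_def wave_ups n_def)
  have si: "lg y * avgI u y = cum u y" for y by (simp add: avgI_def)
  have th: "2 * (lg y * avgI u y) / n = \<theta> y" for y by (simp add: \<theta>_def M si)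
  have hnz: "hh y \<noteq> 0" "n \<noteq> 0" for y using hh(1)[of y] n by auto

  have dA: "(\<alpha> has_real_derivative - \<kappa> * (\<alpha> y - fA (1 / \<kappa>) (lg y) (avgI u y) (hh y) n (\<alpha> y) (\<eta> y))) (at y)" for y
    using newA(2)[OF near k, of y] unfolding fixd srcA_def u_def hh_def n_def .
  have dB: "(\<beta> has_real_derivative \<kappa> * (\<beta> y - fA (- (1 / \<kappa>)) (lg y) (avgI u y) (hh y) n (\<beta> y) (\<eta> y))) (at y)" for y
    using newB(1)[OF near k, of y] unfolding fixd srcA_def u_def hh_def n_def .
  have dE: "(\<eta> has_real_derivative 4 * lg y * (\<eta> y - fE (1 / \<kappa>) (lg y) (avgI u y) (hh y) n (\<alpha> y) (\<beta> y) (\<eta> y))) (at y)" for y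
    using newE(1)[OF near k, of y] unfolding fixd srcE_def u_def hh_def n_def .

  \<comment> \<open>Cancelling s (1 - s) turns G into Green's function applied to u, which can be
    differentiated without quotients.\<close>
  have Gmom: "G y = 4 / n\<^sup>2 * ((1 - lg y) * mom0 u y + lg y * mom1 u y)" for y
  proof -
    have "slope y * hh y = 2 * ((1 - lg y) * mom0 u y + lg y * mom1 u y)"
    proof -
      have "s * r * (2 * a / s + 2 * b / r) = 2 * (r * a + s * b)" if "s \<noteq> 0" "r \<noteq> 0" for s r a b :: real
        using that by (simp add: field_simps)
      then show ?thesis unfolding hh_def avgH_def slope_def by this (rule lg_bounds)+
    qed
    moreover have "G y = 2 / n\<^sup>2 * (slope y * hh y)" by (simp add: G_def M power2_eq_square)
    ultimately show ?thesis by simp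
  qed
  have dG: "(G has_real_derivative wave_height \<kappa> * (slope y * (1 - \<theta> y))) (at y)" for y
  proof -
    \<comment> \<open>The normalisation enters here: \<open>avgN\<close> cut at the current point
      turns the difference of the moments into n / 2 - \<open>cum u y\<close>, which produces the
      factor 1 - theta.\<close>
    have e: "mom1 u y - mom0 u y = n / 2 - cum u y" using avgN_eq[OF bcu, of y] unfolding n_def by argo
    have "((\<lambda>y. 4 / n\<^sup>2 * ((1 - lg y) * mom0 u y + lg y * mom1 u y)) has_real_derivative
        4 / n\<^sup>2 * (slope y * (mom1 u y - mom0 u y))) (at y)"
      by (rule derivative_eq_intros refl DERIV_lg DERIV_mom0[OF bcu] DERIV_mom1[OF bcu])+
         (simp add: slope_def algebra_simps)
    moreover have "4 / n\<^sup>2 * (slope y * (n / 2 - cum u y)) = wave_height \<kappa> * (slope y * (1 - \<theta> y))"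
      unfolding \<theta>_def M using n by (simp add: field_simps power2_eq_square)
    ultimately show ?thesis unfolding Gmom[abs_def] e by simp
  qed
  have d\<theta>: "(\<theta> has_real_derivative wave_height \<kappa> * (slope y * u y)) (at y)" for y
    unfolding \<theta>_def[abs_def] by (rule derivative_eq_intros refl DERIV_cum[OF bcu])+ simp

  obtain Y where Y: "\<And>x. (Y has_real_derivative 1 / (n / hh (Y x))) (at x)" "filterlim Y at_top at_top" "filterlim Y at_bot at_bot"
  proof -
    have "continuous_on UNIV (\<lambda>y. n / hh y)"
      using hnz continuous_avgH[OF bcu] by (intro continuous_intros) (auto simp: hh_def)
    moreover have "n / (34/100) \<le> n / hh y" for y
      using hh[of y] n by (intro divide_left_mono) auto
    moreover have "0 < n / (34/100)" using n by simp
    ultimately show ?thesis using that time_change[of "\<lambda>y. n / hh y" "n / (34/100)"] by blast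
  qed
  have chain: "((\<lambda>x. F (Y x)) has_real_derivative E (Y x)) (at x)"
    if "\<And>y. (F has_real_derivative F' y) (at y)" "\<And>y. hh y / n * F' y = E y" for F F' E x
    using DERIV_chain2[OF that(1) Y(1), of x] that(2)[of "Y x"] by (simp add: mult.commute)

  note xA = chain[OF dA, unfolded rescale_alpha[OF hnz(2,1) k0] th]
    and xB = chain[OF dB, unfolded rescale_beta[OF hnz(2,1) k0] th]
    and xE = chain[OF dE, unfolded rescale_eta[OF hnz(2,1) k0] th]
  have x\<theta>: "((\<lambda>x. \<theta> (Y x)) has_real_derivative u (Y x) * G (Y x)) (at x)" for x
    by (rule chain[OF d\<theta>, of "\<lambda>y. u y * G y"]) (simp add: G_def)
  have xG: "((\<lambda>x. G (Y x)) has_real_derivative (1 - \<theta> (Y x)) * G (Y x)) (at x)" for x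
    by (rule chain[OF dG, of "\<lambda>y. (1 - \<theta> y) * G y"]) (simp add: G_def)
  have xA: "((\<lambda>x. \<alpha> (Y x)) has_real_derivative - (\<kappa> + 1 - \<theta> (Y x)) * \<alpha> (Y x) + \<kappa> * (1 - \<eta> (Y x))) (at x)" for x
    by (rule chain[OF dA, of "\<lambda>y. - (\<kappa> + 1 - \<theta> y) * \<alpha> y + \<kappa> * (1 - \<eta> y)"]) (simp only: rescale_alpha[OF hnz(2,1) k0] th)
  have xB: "((\<lambda>x. \<beta> (Y x)) has_real_derivative (\<kappa> - 1 + \<theta> (Y x)) * \<beta> (Y x) - \<kappa> * (1 - \<eta> (Y x))) (at x)" for x
    by (rule chain[OF dB, of "\<lambda>y. (\<kappa> - 1 + \<theta> y) * \<beta> y - \<kappa> * (1 - \<eta> y)"]) (simp only: rescale_beta[OF hnz(2,1) k0] th)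
  have xE: "((\<lambda>x. \<eta> (Y x)) has_real_derivative 2 * \<theta> (Y x) * \<eta> (Y x) - D (Y x) * u (Y x)) (at x)" for x
  proof (rule chain[OF dE, of "\<lambda>y. 2 * \<theta> y * \<eta> y - D y * u y"])
    fix y
    have "2 / n * (lg y * (1 - lg y)) * (hh y / n) * (\<alpha> y - \<beta> y) / (2 * \<kappa>) = G y * ((\<alpha> y - \<beta> y) / (2 * \<kappa>))"
      by (simp add: G_def M slope_def)
    then show "hh y / n * (4 * lg y * (\<eta> y - fE (1 / \<kappa>) (lg y) (avgI u y) (hh y) n (\<alpha> y) (\<beta> y) (\<eta> y))) = 2 * \<theta> y * \<eta> y - D y * u y"
      unfolding rescale_eta[OF hnz(2,1) k0] th D_def by (simp add: u_def ups_def)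
  qed
  have xW: "((\<lambda>x. wave_height \<kappa> * lg (Y x)) has_real_derivative G (Y x)) (at x)" for x
  proof (rule chain)
    show "((\<lambda>y. wave_height \<kappa> * lg y) has_real_derivative wave_height \<kappa> * slope y) (at y)" for y
      by (rule derivative_eq_intros refl DERIV_lg)+ (simp add: slope_def)
  qed (simp add: G_def)
  have uY: "u y = (\<alpha> y + \<beta> y) / 4" for y by (simp add: u_def ups_def)
  \<comment> \<open>The halved difference of A' = -kappa (A - D') and B' = kappa (B - D'), divided
    by kappa, is - (A + B) / 2 + (1 - eta) G, and 2 theta' = (A + B) / 2 cancels its first
    part.\<close>
  have xD: "((\<lambda>x. D (Y x)) has_real_derivative G (Y x) - \<eta> (Y x) * G (Y x)) (at x)" for x
  proof -
    have "((\<lambda>x. D (Y x)) has_real_derivative 2 * (u (Y x) * G (Y x)) +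
      ((1 - \<theta> (Y x)) * G (Y x) * ((\<alpha> (Y x) - \<beta> (Y x)) / (2 * \<kappa>)) +
       (- (\<kappa> + 1 - \<theta> (Y x)) * \<alpha> (Y x) + \<kappa> * (1 - \<eta> (Y x)) -
        ((\<kappa> - 1 + \<theta> (Y x)) * \<beta> (Y x) - \<kappa> * (1 - \<eta> (Y x)))) / (2 * \<kappa>) * G (Y x))) (at x)"
      unfolding D_def
      by (rule DERIV_add[OF DERIV_cmult[OF x\<theta>] DERIV_mult[OF xG DERIV_cdivide[OF DERIV_diff[OF xA xB]]]])
    moreover have "2 * ((a + b) / 4 * g) + ((1 - t) * g * ((a - b) / (2 * \<kappa>)) +
       (- (\<kappa> + 1 - t) * a + \<kappa> * (1 - e) - ((\<kappa> - 1 + t) * b - \<kappa> * (1 - e))) / (2 * \<kappa>) * g) = g - e * g"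
      for a b g t e :: real
      using k0 by (simp add: field_simps)
    ultimately show ?thesis unfolding uY by simp
  qed
  have xV: "((\<lambda>x. u (Y x) * G (Y x)) has_real_derivative - \<kappa>\<^sup>2 * (- \<theta> (Y x) + D (Y x) / 2)) (at x)" for x
  proof -
    have "((\<lambda>x. u (Y x) * G (Y x)) has_real_derivative
       (- (\<kappa> + 1 - \<theta> (Y x)) * \<alpha> (Y x) + \<kappa> * (1 - \<eta> (Y x)) +
        ((\<kappa> - 1 + \<theta> (Y x)) * \<beta> (Y x) - \<kappa> * (1 - \<eta> (Y x)))) / 4 * G (Y x) +
       (1 - \<theta> (Y x)) * G (Y x) * ((\<alpha> (Y x) + \<beta> (Y x)) / 4)) (at x)"
      unfolding uY by (rule DERIV_mult[OF DERIV_cdivide[OF DERIV_add[OF xA xB]] xG])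
    moreover have "(- (\<kappa> + 1 - t) * a + \<kappa> * (1 - e) + ((\<kappa> - 1 + t) * b - \<kappa> * (1 - e))) / 4 * g + (1 - t) * g * ((a + b) / 4)
      = - \<kappa>\<^sup>2 * (- t + (2 * t + g * ((a - b) / (2 * \<kappa>))) / 2)" for a b g t e :: real
      using k0 by (simp add: power2_eq_square field_simps)
    ultimately show ?thesis unfolding D_def by simp
  qed
  have xH: "((\<lambda>x. \<eta> (Y x) * G (Y x)) has_real_derivative
      (1 + \<theta> (Y x)) * (\<eta> (Y x) * G (Y x)) - u (Y x) * G (Y x) * D (Y x)) (at x)" for x
    by (rule derivative_eq_intros refl xG xE)+ (simp add: algebra_simps)
  have Gnn: "0 \<le> G y" for y unfolding G_def M using n hh(1)[of y] slope_pos[of y] by simp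

  have sl0: "(slope \<longlongrightarrow> 0) at_bot" "(slope \<longlongrightarrow> 0) at_top"
    using tendsto_mult[OF lg_at_bot tendsto_diff[OF tendsto_const[of 1] lg_at_bot]]
      tendsto_mult[OF lg_at_top tendsto_diff[OF tendsto_const[of 1] lg_at_top]]
    by (simp_all add: slope_def[abs_def])
  have G0: "(G \<longlongrightarrow> 0) F" if "(slope \<longlongrightarrow> 0) F" for F
  proof -
    have "\<bar>hh y / n\<bar> \<le> 1 / n" for y using hh[of y] n by (simp add: abs_divide divide_right_mono)
    from tendsto_mult_left[OF null_mult_bounded[OF that this], of "wave_height \<kappa>"] show ?thesis by (simp add: G_def[abs_def])
  qed
  have V0: "((\<lambda>y. u y * G y) \<longlongrightarrow> 0) F" if "(slope \<longlongrightarrow> 0) F" for F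
    using null_mult_bounded[OF G0[OF that] u(2)] by (simp add: mult.commute)
  \<comment> \<open>G vanishes at both ends, so D tends to 2 theta there: the slaving U = -D/2 of
    the limit problem holds exactly in the end states.\<close>
  have D0: "(D \<longlongrightarrow> 2 * t) F" if "(slope \<longlongrightarrow> 0) F" "(\<theta> \<longlongrightarrow> t) F" for F t
  proof -
    have "\<bar>(\<alpha> y - \<beta> y) / (2 * \<kappa>)\<bar> \<le> 1" for y
    proof -
      have "\<bar>\<alpha> y - \<beta> y\<bar> \<le> 1" using nearD(4,5)[OF near, of y] by linarith
      then show ?thesis using k by (simp add: abs_divide)
    qed
    from tendsto_add[OF tendsto_mult_left[OF that(2), of 2] null_mult_bounded[OF G0[OF that(1)] this]]
    show ?thesis by (simp add: D_def[abs_def])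
  qed
  have t0: "(\<theta> \<longlongrightarrow> 0) at_bot" "(\<theta> \<longlongrightarrow> wave_depth \<kappa>) at_top"
    using tendsto_mult_left[OF cum_at_bot[OF bcu], of "wave_height \<kappa>"] tendsto_mult_left[OF total_limit[OF bcu], of "wave_height \<kappa>"]
    by (simp_all add: \<theta>_def[abs_def] wave_depth_def wave_ups)
  have w0: "((\<lambda>y. wave_height \<kappa> * lg y) \<longlongrightarrow> 0) at_bot" "((\<lambda>y. wave_height \<kappa> * lg y) \<longlongrightarrow> wave_height \<kappa>) at_top"
    using tendsto_mult_left[OF lg_at_bot, of "wave_height \<kappa>"] tendsto_mult_left[OF lg_at_top, of "wave_height \<kappa>"] by simp_all

  have "unit_wave \<kappa> (wave_height \<kappa>) (wave_depth \<kappa>) (\<lambda>x. wave_height \<kappa> * lg (Y x)) (\<lambda>x. wave_height \<kappa> * lg (Y x) - D (Y x))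
     (\<lambda>x. G (Y x)) (\<lambda>x. \<eta> (Y x) * G (Y x)) (\<lambda>x. - \<theta> (Y x)) (\<lambda>x. u (Y x) * G (Y x))"
    unfolding unit_wave_def
  proof (intro allI conjI)
    fix x
    show "((\<lambda>x. wave_height \<kappa> * lg (Y x)) has_real_derivative G (Y x)) (at x)" by (rule xW)
    show "((\<lambda>x. wave_height \<kappa> * lg (Y x) - D (Y x)) has_real_derivative \<eta> (Y x) * G (Y x)) (at x)"
      using DERIV_diff[OF xW[of x] xD[of x]] by simp
    show "((\<lambda>x. G (Y x)) has_real_derivative (1 + - \<theta> (Y x)) * G (Y x)) (at x)" using xG[of x] by simp
    show "((\<lambda>x. \<eta> (Y x) * G (Y x)) has_real_derivative (1 - - \<theta> (Y x)) * (\<eta> (Y x) * G (Y x)) -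
         u (Y x) * G (Y x) * (wave_height \<kappa> * lg (Y x) - (wave_height \<kappa> * lg (Y x) - D (Y x)))) (at x)" using xH[of x] by simp
    show "((\<lambda>x. - \<theta> (Y x)) has_real_derivative - (u (Y x) * G (Y x))) (at x)" by (rule DERIV_minus[OF x\<theta>])
    show "((\<lambda>x. u (Y x) * G (Y x)) has_real_derivative - \<kappa>\<^sup>2 *
        (- \<theta> (Y x) + (wave_height \<kappa> * lg (Y x) - (wave_height \<kappa> * lg (Y x) - D (Y x))) / 2)) (at x)" using xV[of x] by simp
    show "0 \<le> u (Y x) * G (Y x)" by (intro mult_nonneg_nonneg u Gnn)
  next
    show "((\<lambda>x. wave_height \<kappa> * lg (Y x)) \<longlongrightarrow> 0) at_bot" "((\<lambda>x. wave_height \<kappa> * lg (Y x)) \<longlongrightarrow> wave_height \<kappa>) at_top"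
      by (rule filterlim_compose[OF w0(1) Y(3)] filterlim_compose[OF w0(2) Y(2)])+
    show "((\<lambda>x. u (Y x) * G (Y x)) \<longlongrightarrow> 0) at_bot" "((\<lambda>x. u (Y x) * G (Y x)) \<longlongrightarrow> 0) at_top"
      by (rule filterlim_compose[OF V0[OF sl0(1)] Y(3)] filterlim_compose[OF V0[OF sl0(2)] Y(2)])+
    show "((\<lambda>x. - \<theta> (Y x)) \<longlongrightarrow> 0) at_bot"
      using tendsto_minus[OF filterlim_compose[OF t0(1) Y(3)]] by simp
    show "((\<lambda>x. - \<theta> (Y x)) \<longlongrightarrow> - wave_depth \<kappa>) at_top"
      by (rule tendsto_minus[OF filterlim_compose[OF t0(2) Y(2)]])
    show "((\<lambda>x. wave_height \<kappa> * lg (Y x) - D (Y x)) \<longlongrightarrow> 0) at_bot"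
      using tendsto_diff[OF filterlim_compose[OF w0(1) Y(3)] filterlim_compose[OF D0[OF sl0(1) t0(1)] Y(3)]] by simp
    show "((\<lambda>x. wave_height \<kappa> * lg (Y x) - D (Y x)) \<longlongrightarrow> wave_height \<kappa> - 2 * wave_depth \<kappa>) at_top"
      by (rule tendsto_diff[OF filterlim_compose[OF w0(2) Y(2)] filterlim_compose[OF D0[OF sl0(2) t0(2)] Y(2)]])
  qed
  then show ?thesis by blast
qed

section \<open>Dependence of the end states on the stiffness\<close>

lemma wave_ups_facts:
  assumes "kappa0 \<le> \<kappa>"
  shows "bounded_cont (wave_ups \<kappa>)" "33/100 < avgN (wave_ups \<kappa>)"
  using near_ups(2)[OF near_cball[OF fixpt(1)[OF assms]]] avgH_pos(2)[OF near_cball[OF fixpt(1)[OF assms]]]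
  unfolding wave_ups_def by auto

text \<open>54 is 36/100 times the Lipschitz constant 150 of the fixed point; the averages preserve
  it.\<close>

lemma wave_ups_diff:
  assumes "kappa0 \<le> \<kappa>1" "kappa0 \<le> \<kappa>2"
  shows "\<bar>avgN (wave_ups \<kappa>1) - avgN (wave_ups \<kappa>2)\<bar> \<le> 54 * \<bar>\<kappa>1 - \<kappa>2\<bar>" "\<bar>total (wave_ups \<kappa>1) - total (wave_ups \<kappa>2)\<bar> \<le> 54 * \<bar>\<kappa>1 - \<kappa>2\<bar>"
proof -
  have "\<bar>wave_ups \<kappa>1 y - wave_ups \<kappa>2 y\<bar> \<le> 54 * \<bar>\<kappa>1 - \<kappa>2\<bar>" for y
    using comp_diff(4)[of "fixpt \<kappa>1" y "fixpt \<kappa>2"] fixpt_lipschitz[OF assms] unfolding wave_ups_def by linarith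
  note * = wave_ups_facts(1)[OF assms(1)] wave_ups_facts(1)[OF assms(2)] this
  show "\<bar>avgN (wave_ups \<kappa>1) - avgN (wave_ups \<kappa>2)\<bar> \<le> 54 * \<bar>\<kappa>1 - \<kappa>2\<bar>" by (rule avgN_diff[OF *])
  show "\<bar>total (wave_ups \<kappa>1) - total (wave_ups \<kappa>2)\<bar> \<le> 54 * \<bar>\<kappa>1 - \<kappa>2\<bar>" by (rule total_diff[OF *])
qed

lemma wave_ups_limit:
  assumes k: "kappa0 \<le> \<kappa>"
  shows "\<bar>avgN (wave_ups \<kappa>) - 1/3\<bar> \<le> 7 / \<kappa>" "\<bar>total (wave_ups \<kappa>) - 1/3\<bar> \<le> 7 / \<kappa>"
proof -
  have "\<bar>wave_ups \<kappa> y - 1/3\<bar> \<le> 7 / \<kappa>" for y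
  proof -
    have "ups (comp_alpha X0) (comp_beta X0) y = 1/3" by (simp add: ups_def)
    moreover have "36/100 * (18 / \<kappa>) \<le> 7 / \<kappa>"
      using divide_right_mono[of "648/100" 7 \<kappa>] k by simp
    ultimately show ?thesis
      using comp_diff(4)[of "fixpt \<kappa>" y X0] fixpt_X0[OF k] unfolding wave_ups_def by linarith
  qed
  note d = this
  have c: "bounded_cont (\<lambda>_. 1/3)" by (auto simp: bounded_cont_def intro: exI[of _ 1])
  show "\<bar>avgN (wave_ups \<kappa>) - 1/3\<bar> \<le> 7 / \<kappa>" "\<bar>total (wave_ups \<kappa>) - 1/3\<bar> \<le> 7 / \<kappa>"
    using avgN_diff[OF wave_ups_facts(1)[OF k] c d] total_diff[OF wave_ups_facts(1)[OF k] c d]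
    by (simp_all only: avgN_const total_const)
qed

lemma lipschitz_continuous:
  fixes f :: "real \<Rightarrow> real"
  assumes "\<And>x y. x \<in> S \<Longrightarrow> y \<in> S \<Longrightarrow> \<bar>f x - f y\<bar> \<le> B * \<bar>x - y\<bar>" "0 \<le> B"
  shows "continuous_on S f"
  using assms by (intro lipschitz_on_continuous_on[of B] lipschitz_onI) (auto simp: dist_real_def)

lemma continuous_wave_height: "continuous_on {kappa0..} wave_height" and continuous_wave_depth: "continuous_on {kappa0..} wave_depth"
proof -
  have 1: "continuous_on {kappa0..} (\<lambda>\<kappa>. avgN (wave_ups \<kappa>))" and 2: "continuous_on {kappa0..} (\<lambda>\<kappa>. total (wave_ups \<kappa>))"
    by (rule lipschitz_continuous[of _ _ 54]; use wave_ups_diff in simp)+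
  have nz: "avgN (wave_ups \<kappa>) \<noteq> 0" if "kappa0 \<le> \<kappa>" for \<kappa> using wave_ups_facts(2)[OF that] by auto
  show "continuous_on {kappa0..} wave_height" unfolding wave_height_def[abs_def] using nz by (intro continuous_intros 1) auto
  then show "continuous_on {kappa0..} wave_depth" unfolding wave_depth_def[abs_def] by (intro continuous_intros 2)
qed

text \<open>At the base point u = 1/3, so M = 2 / (1/3) = 6 and m = 6 (1/3) = 2; W2 then ends at 6 -
  4 = 2.\<close>

lemma limit_wave_height: "(wave_height \<longlongrightarrow> 6) at_top" and limit_wave_depth: "(wave_depth \<longlongrightarrow> 2) at_top"
proof -
  have z: "((\<lambda>\<kappa>::real. 7 / \<kappa>) \<longlongrightarrow> 0) at_top"
    by (rule tendsto_divide_0[OF tendsto_const filterlim_at_top_imp_at_infinity[OF filterlim_ident]])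
  have ev: "\<forall>\<^sub>F \<kappa> in at_top. kappa0 \<le> \<kappa>" by (rule eventually_ge_at_top)
  have "((\<lambda>\<kappa>. avgN (wave_ups \<kappa>) - 1/3) \<longlongrightarrow> 0) at_top"
    by (rule Lim_null_comparison[OF _ z], rule eventually_mono[OF ev]) (use wave_ups_limit in simp)
  then have 1: "((\<lambda>\<kappa>. avgN (wave_ups \<kappa>)) \<longlongrightarrow> 1/3) at_top" by (rule LIM_zero_cancel)
  have "((\<lambda>\<kappa>. total (wave_ups \<kappa>) - 1/3) \<longlongrightarrow> 0) at_top"
    by (rule Lim_null_comparison[OF _ z], rule eventually_mono[OF ev]) (use wave_ups_limit in simp)
  then have 2: "((\<lambda>\<kappa>. total (wave_ups \<kappa>)) \<longlongrightarrow> 1/3) at_top" by (rule LIM_zero_cancel)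
  have "((\<lambda>\<kappa>. 2 / avgN (wave_ups \<kappa>)) \<longlongrightarrow> 2 / (1/3)) at_top" by (intro tendsto_intros 1) simp
  then show 3: "(wave_height \<longlongrightarrow> 6) at_top" by (simp add: wave_height_def[abs_def])
  show "(wave_depth \<longlongrightarrow> 2) at_top" using tendsto_mult[OF 3 2] by (simp add: wave_depth_def[abs_def])
qed

section \<open>From the stiffness to speed and tube parameter\<close>

definition stiff :: "real \<Rightarrow> real \<Rightarrow> real" where "stiff c l = sqrt 2 / (c * l)"

text \<open>\<open>stiff\<close> solves the scaling condition for kappa; c < 1 and l < 1 /
  \<open>kappa0\<close> make it at least \<open>kappa0\<close>, since sqrt 2 >= 1.\<close>

lemma stiff_facts:
  assumes "0 < c" "c < 1" "0 < l" "l < 1 / kappa0"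
  shows "kappa0 \<le> stiff c l" "(stiff c l)\<^sup>2 * (c * l)\<^sup>2 = 2"
proof -
  have "c * l \<le> 1 * (1 / kappa0)" using assms by (intro mult_mono) auto
  then have "kappa0 * (c * l) \<le> sqrt 2" using real_sqrt_ge_1_iff[of 2] by linarith
  then show "kappa0 \<le> stiff c l" using assms by (simp add: stiff_def pos_le_divide_eq)
  show "(stiff c l)\<^sup>2 * (c * l)\<^sup>2 = 2" using assms by (simp add: stiff_def power_divide)
qed

lemma stiff_at_top: "0 < c \<Longrightarrow> filterlim (stiff c) at_top (at_right 0)"
proof -
  assume c: "0 < c"
  have "filterlim (\<lambda>l. inverse l * (sqrt 2 / c)) at_top (at_right 0)"
    using c by (intro filterlim_at_top_mult_tendsto_pos[OF tendsto_const] filterlim_inverse_at_top_right) auto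
  then show ?thesis by (simp add: stiff_def[abs_def] field_simps)
qed

text \<open>\<open>c\<close> maps the signed speed to |v|; it is \<open>uminus\<close> for
  left-going and the identity for right-going waves.\<close>

lemma continuous_stiff:
  assumes F: "continuous_on {kappa0..} F" and s: "\<And>p. p \<in> S \<Longrightarrow> 0 < c (fst p) \<and> c (fst p) < 1 \<and> 0 < snd p \<and> snd p < 1 / kappa0"
    and c: "continuous_on UNIV c"
  shows "continuous_on S (\<lambda>p. F (stiff (c (fst p)) (snd p)) :: real)"
proof (rule continuous_on_compose2[OF F])
  have "continuous_on S (\<lambda>p. c (fst p))" by (intro continuous_on_compose2[OF c] continuous_intros) auto
  then show "continuous_on S (\<lambda>p. stiff (c (fst p)) (snd p))"
    unfolding stiff_def
  proof (intro continuous_intros ballI)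
    show "c (fst p) * snd p \<noteq> 0" if "p \<in> S" for p using s[OF that] by auto
  qed
  show "(\<lambda>p. stiff (c (fst p)) (snd p)) ` S \<subseteq> {kappa0..}" using s stiff_facts(1) by auto
qed

theorem theorem4:
  shows
  "(\<exists>l0 \<delta> :: real. l0 > 0 \<and> \<delta> > 0 \<and>
     (\<exists>cs1 cs2 :: real \<Rightarrow> real \<Rightarrow> real.
        continuous_on ({-1/4 - \<delta> <..< -1/4 + \<delta>} \<times> {0<..<l0}) (\<lambda>p. cs1 (fst p) (snd p)) \<and>
        continuous_on ({-1/4 - \<delta> <..< -1/4 + \<delta>} \<times> {0<..<l0}) (\<lambda>p. cs2 (fst p) (snd p)) \<and>
        (\<forall>v \<in> {-1/4 - \<delta> <..< -1/4 + \<delta>}.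
           ((\<lambda>l. cs1 v l) \<longlongrightarrow> -6 * v - 1) (at_right 0) \<and>
           ((\<lambda>l. cs2 v l) \<longlongrightarrow> -2 * v - 1) (at_right 0)) \<and>
        (\<forall>v \<in> {-1/4 - \<delta> <..< -1/4 + \<delta>}. \<forall>l \<in> {0<..<l0}.
           ipm_traveling_wave l v (-1, -1, 0, 0, 0)
             (cs1 v l, cs2 v l, (cs2 v l - cs1 v l) / 2, (cs1 v l - cs2 v l) / 2, 0)))) \<and>
   (\<exists>l0 \<delta> :: real. l0 > 0 \<and> \<delta> > 0 \<and>
     (\<exists>cs1 cs2 :: real \<Rightarrow> real \<Rightarrow> real.
        continuous_on ({1/4 - \<delta> <..< 1/4 + \<delta>} \<times> {0<..<l0}) (\<lambda>p. cs1 (fst p) (snd p)) \<and>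
        continuous_on ({1/4 - \<delta> <..< 1/4 + \<delta>} \<times> {0<..<l0}) (\<lambda>p. cs2 (fst p) (snd p)) \<and>
        (\<forall>v \<in> {1/4 - \<delta> <..< 1/4 + \<delta>}.
           ((\<lambda>l. cs1 v l) \<longlongrightarrow> -2 * v + 1) (at_right 0) \<and>
           ((\<lambda>l. cs2 v l) \<longlongrightarrow> -6 * v + 1) (at_right 0)) \<and>
        (\<forall>v \<in> {1/4 - \<delta> <..< 1/4 + \<delta>}. \<forall>l \<in> {0<..<l0}.
           ipm_traveling_wave l v
             (cs1 v l, cs2 v l, (cs2 v l - cs1 v l) / 2, (cs1 v l - cs2 v l) / 2, 0)
             (1, 1, 0, 0, 0))))"
proof (intro conjI)
  \<comment> \<open>With 1/8 the speeds satisfy 1/8 < |v| < 3/8: they keep their sign and stay below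
    1, as the stiffness bound requires.\<close>
  have ex: "\<exists>l0 \<delta> :: real. l0 > 0 \<and> \<delta> > 0 \<and> (\<exists>cs1 cs2. Q l0 \<delta> cs1 cs2)" if "Q (1 / kappa0) (1 / 8) cs1 cs2"
    for Q and cs1 cs2 :: "real \<Rightarrow> real \<Rightarrow> real"
  proof (intro exI conjI)
    show "Q (1 / kappa0) (1 / 8) cs1 cs2" by (rule that)
  qed simp_all
  have wave: "\<exists>W1 W2 G H U V. unit_wave (stiff c l) (wave_height (stiff c l)) (wave_depth (stiff c l)) W1 W2 G H U V"
    if "0 < c" "c < 1" "0 < l" "l < 1 / kappa0" for c l
    by (rule unit_wave_exists[OF stiff_facts(1)[OF that]])
  have lim: "((\<lambda>l. wave_height (stiff c l)) \<longlongrightarrow> 6) (at_right 0)" "((\<lambda>l. wave_depth (stiff c l)) \<longlongrightarrow> 2) (at_right 0)" if "0 < c" for c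
    by (rule filterlim_compose[OF limit_wave_height stiff_at_top[OF that]] filterlim_compose[OF limit_wave_depth stiff_at_top[OF that]])+
  show "\<exists>l0 \<delta> :: real. l0 > 0 \<and> \<delta> > 0 \<and>
     (\<exists>cs1 cs2 :: real \<Rightarrow> real \<Rightarrow> real.
        continuous_on ({-1/4 - \<delta> <..< -1/4 + \<delta>} \<times> {0<..<l0}) (\<lambda>p. cs1 (fst p) (snd p)) \<and>
        continuous_on ({-1/4 - \<delta> <..< -1/4 + \<delta>} \<times> {0<..<l0}) (\<lambda>p. cs2 (fst p) (snd p)) \<and>
        (\<forall>v \<in> {-1/4 - \<delta> <..< -1/4 + \<delta>}.
           ((\<lambda>l. cs1 v l) \<longlongrightarrow> -6 * v - 1) (at_right 0) \<and>
           ((\<lambda>l. cs2 v l) \<longlongrightarrow> -2 * v - 1) (at_right 0)) \<and>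
        (\<forall>v \<in> {-1/4 - \<delta> <..< -1/4 + \<delta>}. \<forall>l \<in> {0<..<l0}.
           ipm_traveling_wave l v (-1, -1, 0, 0, 0)
             (cs1 v l, cs2 v l, (cs2 v l - cs1 v l) / 2, (cs1 v l - cs2 v l) / 2, 0)))"
  \<comment> \<open>The end values are -1 + c M and -1 + c (M - 2 m) with c = -v; M -> 6 and m -> 2
    give the limits.\<close>
  proof (rule ex[of _ "\<lambda>v l. - 1 + (- v) * wave_height (stiff (- v) l)" "\<lambda>v l. - 1 + (- v) * (wave_height (stiff (- v) l) - 2 * wave_depth (stiff (- v) l))"],
      intro conjI ballI)
    let ?S = "{-1/4 - 1/8 <..< -1/4 + 1/8 :: real} \<times> {0<..<1 / kappa0}"
    have S: "0 < - fst p \<and> - fst p < 1 \<and> 0 < snd p \<and> snd p < 1 / kappa0" if "p \<in> ?S" for p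
      using that by auto
    have c: "continuous_on UNIV (uminus :: real \<Rightarrow> real)" by (intro continuous_intros)
    note cont = continuous_stiff[OF continuous_wave_height S c] continuous_stiff[OF continuous_wave_depth S c]
    show "continuous_on ?S (\<lambda>p. - 1 + - fst p * wave_height (stiff (- fst p) (snd p)))"
      by (intro continuous_intros cont)
    show "continuous_on ?S (\<lambda>p. - 1 + - fst p * (wave_height (stiff (- fst p) (snd p)) - 2 * wave_depth (stiff (- fst p) (snd p))))"
      by (intro continuous_intros cont)
  next
    fix v :: real assume v: "v \<in> {-1/4 - 1/8 <..< -1/4 + 1/8}"
    then have c: "0 < - v" by auto
    have "((\<lambda>l. - 1 + - v * wave_height (stiff (- v) l)) \<longlongrightarrow> - 1 + - v * 6) (at_right 0)"
      by (intro tendsto_intros lim c)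
    moreover have "- 1 + - v * 6 = - 6 * v - 1" by simp
    ultimately show "((\<lambda>l. - 1 + - v * wave_height (stiff (- v) l)) \<longlongrightarrow> - 6 * v - 1) (at_right 0)"
      by (simp only:)
    have "((\<lambda>l. - 1 + - v * (wave_height (stiff (- v) l) - 2 * wave_depth (stiff (- v) l))) \<longlongrightarrow> - 1 + - v * (6 - 2 * 2)) (at_right 0)"
      by (intro tendsto_intros lim c)
    moreover have "- 1 + - v * (6 - 2 * 2) = - 2 * v - 1" by simp
    ultimately show "((\<lambda>l. - 1 + - v * (wave_height (stiff (- v) l) - 2 * wave_depth (stiff (- v) l))) \<longlongrightarrow> - 2 * v - 1) (at_right 0)"
      by (simp only:)
  next
    fix v l :: real assume v: "v \<in> {-1/4 - 1/8 <..< -1/4 + 1/8}" and l: "l \<in> {0<..<1 / kappa0}"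
    then have c: "0 < - v" "- v < 1" "0 < l" "l < 1 / kappa0" by auto
    from wave[OF c] obtain W1 W2 G H U V where
      "unit_wave (stiff (- v) l) (wave_height (stiff (- v) l)) (wave_depth (stiff (- v) l)) W1 W2 G H U V" by blast
    from traveling_wave_neg[OF this c(3,1) stiff_facts(2)[OF c]]
    show "ipm_traveling_wave l v (-1, -1, 0, 0, 0)
      (- 1 + - v * wave_height (stiff (- v) l), - 1 + - v * (wave_height (stiff (- v) l) - 2 * wave_depth (stiff (- v) l)),
       (- 1 + - v * (wave_height (stiff (- v) l) - 2 * wave_depth (stiff (- v) l)) - (- 1 + - v * wave_height (stiff (- v) l))) / 2,
       (- 1 + - v * wave_height (stiff (- v) l) - (- 1 + - v * (wave_height (stiff (- v) l) - 2 * wave_depth (stiff (- v) l)))) / 2, 0)"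
      by (simp add: algebra_simps)
  qed
  show "\<exists>l0 \<delta> :: real. l0 > 0 \<and> \<delta> > 0 \<and>
     (\<exists>cs1 cs2 :: real \<Rightarrow> real \<Rightarrow> real.
        continuous_on ({1/4 - \<delta> <..< 1/4 + \<delta>} \<times> {0<..<l0}) (\<lambda>p. cs1 (fst p) (snd p)) \<and>
        continuous_on ({1/4 - \<delta> <..< 1/4 + \<delta>} \<times> {0<..<l0}) (\<lambda>p. cs2 (fst p) (snd p)) \<and>
        (\<forall>v \<in> {1/4 - \<delta> <..< 1/4 + \<delta>}.
           ((\<lambda>l. cs1 v l) \<longlongrightarrow> -2 * v + 1) (at_right 0) \<and>
           ((\<lambda>l. cs2 v l) \<longlongrightarrow> -6 * v + 1) (at_right 0)) \<and>
        (\<forall>v \<in> {1/4 - \<delta> <..< 1/4 + \<delta>}. \<forall>l \<in> {0<..<l0}.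
           ipm_traveling_wave l v
             (cs1 v l, cs2 v l, (cs2 v l - cs1 v l) / 2, (cs1 v l - cs2 v l) / 2, 0)
             (1, 1, 0, 0, 0)))"
  \<comment> \<open>By the reflection C1 comes from W2 and C2 from W1, hence the coefficient 2 for
    the first concentration and 6 for the second.\<close>
  proof (rule ex[of _ "\<lambda>v l. 1 - v * (wave_height (stiff v l) - 2 * wave_depth (stiff v l))" "\<lambda>v l. 1 - v * wave_height (stiff v l)"],
      intro conjI ballI)
    let ?S = "{1/4 - 1/8 <..< 1/4 + 1/8 :: real} \<times> {0<..<1 / kappa0}"
    have S: "0 < fst p \<and> fst p < 1 \<and> 0 < snd p \<and> snd p < 1 / kappa0" if "p \<in> ?S" for p
      using that by auto
    have c: "continuous_on UNIV (\<lambda>v::real. v)" by (intro continuous_intros)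
    note cont = continuous_stiff[OF continuous_wave_height S c] continuous_stiff[OF continuous_wave_depth S c]
    show "continuous_on ?S (\<lambda>p. 1 - fst p * wave_height (stiff (fst p) (snd p)))"
      by (intro continuous_intros cont)
    show "continuous_on ?S (\<lambda>p. 1 - fst p * (wave_height (stiff (fst p) (snd p)) - 2 * wave_depth (stiff (fst p) (snd p))))"
      by (intro continuous_intros cont)
  next
    fix v :: real assume v: "v \<in> {1/4 - 1/8 <..< 1/4 + 1/8}"
    then have c: "0 < v" by auto
    have "((\<lambda>l. 1 - v * wave_height (stiff v l)) \<longlongrightarrow> 1 - v * 6) (at_right 0)"
      by (intro tendsto_intros lim c)
    moreover have "1 - v * 6 = - 6 * v + 1" by simp
    ultimately show "((\<lambda>l. 1 - v * wave_height (stiff v l)) \<longlongrightarrow> - 6 * v + 1) (at_right 0)"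
      by (simp only:)
    have "((\<lambda>l. 1 - v * (wave_height (stiff v l) - 2 * wave_depth (stiff v l))) \<longlongrightarrow> 1 - v * (6 - 2 * 2)) (at_right 0)"
      by (intro tendsto_intros lim c)
    moreover have "1 - v * (6 - 2 * 2) = - 2 * v + 1" by simp
    ultimately show "((\<lambda>l. 1 - v * (wave_height (stiff v l) - 2 * wave_depth (stiff v l))) \<longlongrightarrow> - 2 * v + 1) (at_right 0)"
      by (simp only:)
  next
    fix v l :: real assume v: "v \<in> {1/4 - 1/8 <..< 1/4 + 1/8}" and l: "l \<in> {0<..<1 / kappa0}"
    then have c: "0 < v" "v < 1" "0 < l" "l < 1 / kappa0" by auto
    from wave[OF c] obtain W1 W2 G H U V where
      "unit_wave (stiff v l) (wave_height (stiff v l)) (wave_depth (stiff v l)) W1 W2 G H U V" by blast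
    from traveling_wave_pos[OF this c(3,1) stiff_facts(2)[OF c]]
    show "ipm_traveling_wave l v
      (1 - v * (wave_height (stiff v l) - 2 * wave_depth (stiff v l)), 1 - v * wave_height (stiff v l),
       (1 - v * wave_height (stiff v l) - (1 - v * (wave_height (stiff v l) - 2 * wave_depth (stiff v l)))) / 2,
       (1 - v * (wave_height (stiff v l) - 2 * wave_depth (stiff v l)) - (1 - v * wave_height (stiff v l))) / 2, 0) (1, 1, 0, 0, 0)"
      by (simp add: algebra_simps)
  qed
qed

end
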